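(* Let $\tilde F(K)$ be the forbidden number and $RA(K)$ the region arc shift number of a twisted knot $K$. Then $RA(K)\le \tilde F(K)$.
   Context: **Twisted knots.** A twisted knot diagram is a generic closed oriented curve in $\mathbb{R}^2$ whose double points are each marked either as a classical crossing (with over/under information, hence a sign $\pm1$) or as a virtual crossing, and which carries finitely many bars (short transverse marks) placed on the curve away from the double points. Its Gauss diagram is an oriented circle parametrizing the curve, with one chord for each classical crossing joining its two preimages, directed from the over endpoint to the under endpoint and labelled with the sign, and with the bars recorded as marked points on the circle; virtual crossings are not recorded. Two diagrams are equivalent if they are related by planar isotopy and the extended Reidemeister moves: the classical moves $R_1,R_2,R_3$; the virtual moves $V_1,V_2,V_3,V_4$ (the Reidemeister moves with all crossings virtual, and the move passing a strand with only virtual crossings across a classical crossing); $T_1$ (a bar slides along its strand through a virtual crossing); $T_2$ (two adjacent bars on the same edge are created or deleted); and $T_3$ (whose effect on Gauss diagrams is: a chord has its direction reversed, its sign kept, and one bar is added on each of the four circle segments adjacent to its two endpoints, or the inverse). The moves $V_1$--$V_4,T_1$ do not change Gauss diagrams, and two diagrams are equivalent iff their Gauss diagrams are related by finitely many moves $R_1,R_2,R_3,T_2,T_3$ (no bars lie between the endpoints required to be adjacent in $R_1,R_2,R_3$). A twisted knot is an equivalence class of diagrams. A trivial twisted knot is the classical unknot (crossingless circle) with no bar or with one bar. **Forbidden moves and forbidden number.** On Gauss diagrams: $F_1$ (resp. $F_2$) interchanges two neighbouring over (resp. under) endpoints of two different chords, with no bar between them; $F_3$ (resp. $F_4$) interchanges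 two neighbouring over (resp. under) endpoints of two different chords having exactly one bar between them, the bar staying between them; in all of these, signs and directions of chords are unchanged. $T_4$ deletes a chord whose two endpoints are neighbouring except for exactly one bar between them, leaving the bar. The forbidden number $\tilde F(K)$ is the minimum number of forbidden moves ($F_1$ (or $F_2$), $F_3$ (or $F_4$), $T_4$) needed, together with any number of extended Reidemeister moves, to transform a diagram of $K$ into a diagram of a trivial twisted knot (finite by a known theorem of Xue and Deng). **Arc shift move.** An arc $(a,b)$ of a diagram is a segment of the curve passing through exactly one pair of crossings $(c_1,c_2)$ (each classical or virtual), with end $a$ incident to $c_1$ and end $b$ incident to $c_2$; bars may or may not lie between the two crossings. The arc shift move on $(a,b)$ cuts the arc at two points near $a$ and near $b$ and reconnects the four loose ends so that the middle piece is traversed in the opposite direction; the middle piece, with its bars and the over/under information at $c_1,c_2$, is left in place, and all newly created crossings are virtual. Effect on the Gauss diagram: the order along the knot of the two endpoints belonging to the arc is interchanged (bars between them remain between them), and the signs of those of $c_1,c_2$ that are classical are changed (for $c_1\ne c_2$). **Region arc shift number.** Let $D_G$ be the 4-valent plane graph obtained from a diagram $D$ by putting a vertex at each classical and virtual crossing. A region of $D$ is a connected component of $\mathbb{R}^2\setminus D_G$. The region arc shift move at a region $R$ applies the arc shift move once to each arc of the boundary of $R$ (one arc for each boundary edge, containing that edge and passing through its two end crossings). The region arc shift number $RA(K)$ is the minimum number of region arc shift moves needed, together with any number of extended Reidemeister moves, to transform a diagram of $K$ into a diagram of a trivial twisted knot. *)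

theory Defs
  imports Main "HOL-Library.Extended_Nat" "HOL-Combinatorics.Orbits"
begin

text \<open>
  A diagram is recorded by the cyclic word read off along the oriented curve, starting anywhere
  except at a double point or a bar.

  \<^item> \<open>Classical c ov pos\<close>: the curve passes through the classical crossing \<open>c\<close>, on the over strand
    iff \<open>ov\<close>; the crossing has sign \<open>+1\<close> iff \<open>pos\<close>.
  \<^item> \<open>Virtual v l\<close>: the curve passes through the virtual crossing \<open>v\<close>. Of the two passages the one
    with \<open>l = True\<close> sees the other strand crossing from its right to its left, i.e. (direction of
    the \<open>True\<close> passage, direction of the \<open>False\<close> passage) is a positive basis of the plane.

  A Gauss diagram is such a word without \<open>Virtual\<close> letters: a chord is the pair of letters carrying
  the same name, directed from the over letter to the under letter.
\<close>

datatype 'c letter = Bar | Classical 'c bool bool | Virtual 'c bool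

type_synonym word = "nat letter list"

fun is_virtual :: "'c letter \<Rightarrow> bool" where
  "is_virtual (Virtual v l) = True"
| "is_virtual _ = False"

text \<open>The other passage through the same crossing.\<close>

fun opp :: "'c letter \<Rightarrow> 'c letter" where
  "opp Bar = Bar"
| "opp (Classical c ov pos) = Classical c (\<not> ov) pos"
| "opp (Virtual v l) = Virtual v (\<not> l)"

definition passages :: "word \<Rightarrow> word" where
  "passages w = filter (\<lambda>x. x \<noteq> Bar) w"

text \<open>Every crossing is passed exactly twice, and both passages carry the same sign.\<close>

definition well_formed :: "word \<Rightarrow> bool" where
  "well_formed w \<longleftrightarrow>
     distinct (passages w) \<and>
     (\<forall>p \<in> set (passages w). opp p \<in> set (passages w)) \<and>
     (\<forall>c ov pos ov' pos'. Classical c ov pos \<in> set w \<and> Classical c ov' pos' \<in> set w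
        \<longrightarrow> pos = pos')"

definition gauss_diagram :: "word \<Rightarrow> bool" where
  "gauss_diagram w \<longleftrightarrow> well_formed w \<and> (\<forall>x \<in> set w. \<not> is_virtual x)"

definition gauss :: "word \<Rightarrow> word" where
  "gauss w = filter (\<lambda>x. \<not> is_virtual x) w"


section \<open>Planar diagrams and their regions\<close>

text \<open>
  In a well-formed word each passage occurs once, so an edge of the 4-valent graph \<open>D\<^sub>G\<close> is named by
  the passage \<open>p\<close> at which it starts; it ends at \<open>next_passage w p\<close>.
\<close>

definition next_passage :: "word \<Rightarrow> nat letter \<Rightarrow> nat letter" where
  "next_passage w p = the (map_of (zip (passages w) (rotate1 (passages w))) p)"

definition prev_passage :: "word \<Rightarrow> nat letter \<Rightarrow> nat letter" where
  "prev_passage w p = the (map_of (zip (rotate1 (passages w)) (passages w)) p)"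

text \<open>
  \<open>leftward p\<close>: the other strand at the crossing runs from the right to the left of the passage \<open>p\<close>.
  At a classical crossing this holds for the over passage iff the sign is \<open>+1\<close>.
\<close>

fun leftward :: "'c letter \<Rightarrow> bool" where
  "leftward Bar = False"
| "leftward (Classical c ov pos) = (ov = pos)"
| "leftward (Virtual v l) = l"

text \<open>
  A dart \<open>(p, True)\<close> is the edge starting at \<open>p\<close>, traversed along the orientation of the knot;
  \<open>(p, False)\<close> is the same edge traversed backwards. \<open>face_step\<close> follows a dart to its final
  crossing and turns left there, so its cycles trace the boundaries of the regions, each region
  lying to the left of its darts.
\<close>

fun face_step :: "word \<Rightarrow> nat letter \<times> bool \<Rightarrow> nat letter \<times> bool" where
  "face_step w (p, True) =
     (let q = next_passage w p in
      if leftward q then (opp q, True) else (prev_passage w (opp q), False))"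
| "face_step w (p, False) =
     (if leftward p then (prev_passage w (opp p), False) else (opp p, True))"

definition darts :: "word \<Rightarrow> (nat letter \<times> bool) set" where
  "darts w = set (passages w) \<times> UNIV"

definition regions :: "word \<Rightarrow> (nat letter \<times> bool) set set" where
  "regions w = orbit (face_step w) ` darts w"

text \<open>
  The graph of a knot diagram is connected, so a word is the word of a plane curve iff Euler's
  formula \<open>V + F = E + 2\<close> holds. The circle without crossings has no vertex and no dart and is
  admitted separately; its two regions have no boundary edge in the sense above, and a region arc
  shift at them would do nothing.
\<close>

definition planar :: "word \<Rightarrow> bool" where
  "planar w \<longleftrightarrow> passages w = [] \<or>
     length (passages w) div 2 + card (regions w) = length (passages w) + 2"

definition diagrams :: "word set" where
  "diagrams = {w. well_formed w \<and> planar w}"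


section \<open>Equivalence of diagrams; twisted knots\<close>

text \<open>
  \<open>rotate\<close> and \<open>rename\<close> do not change the Gauss diagram, only its encoding. As the circle can be
  rotated, it is enough to state the local moves at convenient places of the word.

  In \<open>R3\<close>, the chords \<open>a\<close>, \<open>b\<close>, \<open>c\<close> run from the top strand to the middle one, from the top to the
  bottom and from the middle to the bottom one. For strands with directions \<open>t\<close>, \<open>m\<close>, \<open>l\<close> the
  triangle closes up, i.e. \<open>\<alpha> t + \<gamma> l = \<beta> m\<close>, where \<open>\<alpha>\<close>, \<open>\<beta>\<close>, \<open>\<gamma>\<close> are positive iff \<open>a\<close> precedes \<open>b\<close>
  on the top, \<open>a\<close> precedes \<open>c\<close> on the middle, \<open>b\<close> precedes \<open>c\<close> on the bottom strand. The signs of the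
  crossings being those of \<open>det (t, m)\<close>, \<open>det (t, l)\<close>, \<open>det (m, l)\<close>, the configuration is
  geometric iff \<open>sgn \<alpha> = sgn \<gamma> * sign a * sign c\<close> and \<open>sgn \<beta> = sgn \<gamma> * sign a * sign b\<close>. The move
  reverses the order on all three strands. All cyclic orders of the three strands along the knot
  are covered by \<open>R3\<close> and \<open>R3'\<close>.
\<close>

definition pair_in_order :: "bool \<Rightarrow> 'a \<Rightarrow> 'a \<Rightarrow> 'a list" where
  "pair_in_order fwd x y = (if fwd then [x, y] else [y, x])"

definition r3_triangle :: "word \<Rightarrow> word \<Rightarrow> word \<Rightarrow> bool" where
  "r3_triangle tops mids bots \<longleftrightarrow>
     (\<exists>a b c sa sb sc \<alpha> \<beta> \<gamma>.
        \<alpha> = (\<gamma> = (sa = sc)) \<and> \<beta> = (\<gamma> = (sa = sb)) \<and>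
        tops = pair_in_order \<alpha> (Classical a True sa) (Classical b True sb) \<and>
        mids = pair_in_order \<beta> (Classical a False sa) (Classical c True sc) \<and>
        bots = pair_in_order \<gamma> (Classical b False sb) (Classical c False sc))"

inductive local_move :: "word \<Rightarrow> word \<Rightarrow> bool" where
  rotate: "local_move (u @ v) (v @ u)"
| rename: "inj f \<Longrightarrow> local_move w (map (map_letter f) w)"
| R1: "local_move (u @ v) (u @ [Classical c ov s, Classical c (\<not> ov) s] @ v)"
| R2_parallel:
    "local_move (u @ v @ x)
       (u @ [Classical c True s, Classical d True (\<not> s)] @ v
          @ [Classical c False s, Classical d False (\<not> s)] @ x)"
| R2_antiparallel:
    "local_move (u @ v @ x)
       (u @ [Classical c True s, Classical d True (\<not> s)] @ v
          @ [Classical d False (\<not> s), Classical c False s] @ x)"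
| R3: "r3_triangle tops mids bots \<Longrightarrow>
    local_move (tops @ u @ mids @ v @ bots @ x) (rev tops @ u @ rev mids @ v @ rev bots @ x)"
| R3': "r3_triangle tops mids bots \<Longrightarrow>
    local_move (tops @ u @ bots @ v @ mids @ x) (rev tops @ u @ rev bots @ v @ rev mids @ x)"
| T2: "local_move (u @ v) (u @ [Bar, Bar] @ v)"
| T3: "local_move (u @ [Classical c ov s] @ v @ [Classical c (\<not> ov) s] @ x)
    (u @ [Bar, Classical c (\<not> ov) s, Bar] @ v @ [Bar, Classical c ov s, Bar] @ x)"

text \<open>
  Well-formedness of both words forces the names of newly created chords to be fresh.
\<close>

definition gauss_move :: "word \<Rightarrow> word \<Rightarrow> bool" where
  "gauss_move w w' \<longleftrightarrow> gauss_diagram w \<and> gauss_diagram w' \<and> local_move w w'"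

text \<open>
  The moves \<open>V\<^sub>1\<close>--\<open>V\<^sub>4\<close> and \<open>T\<^sub>1\<close> do not change Gauss diagrams, and plane diagrams are equivalent iff
  their Gauss diagrams are related by the moves above and their inverses.
\<close>

definition diagram_equiv :: "word rel" where
  "diagram_equiv = {(D, D'). D \<in> diagrams \<and> D' \<in> diagrams
     \<and> equivclp gauss_move (gauss D) (gauss D')}"

definition twisted_knots :: "word set set" where
  "twisted_knots = diagrams // diagram_equiv"

definition trivial_diagrams :: "word set" where
  "trivial_diagrams = diagram_equiv `` {[], [Bar]}"


section \<open>Forbidden moves and arc shifts\<close>

text \<open>
  \<open>F12\<close> is the move \<open>F\<^sub>1\<close> for \<open>ov = True\<close> and \<open>F\<^sub>2\<close> for \<open>ov = False\<close>; similarly for \<open>F34\<close>.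
\<close>

inductive forbidden :: "word \<Rightarrow> word \<Rightarrow> bool" where
  F12: "forbidden (u @ [Classical c ov s, Classical d ov t] @ v)
                  (u @ [Classical d ov t, Classical c ov s] @ v)"
| F34: "forbidden (u @ [Classical c ov s, Bar, Classical d ov t] @ v)
                  (u @ [Classical d ov t, Bar, Classical c ov s] @ v)"
| T4: "forbidden (u @ [Classical c ov s, Bar, Classical c (\<not> ov) s] @ v) (u @ [Bar] @ v)"

definition forbidden_move :: "word rel" where
  "forbidden_move = {(D, D'). D \<in> diagrams \<and> D' \<in> diagrams \<and> forbidden (gauss D) (gauss D')}"

text \<open>
  The arc named \<open>p\<close> is the arc containing the edge from \<open>p\<close> to \<open>next_passage w p\<close> and passing
  through these two passages only. For a set \<open>A\<close> of pairwise disjoint arcs, \<open>arc_shift w A\<close> applies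
  the arc shift move once to each arc in \<open>A\<close>: the two passages of the arc are interchanged, while the
  bars keep their places, hence stay between them. Traversing one of the two strands at a crossing
  backwards changes its sign (for a virtual crossing, interchanges left and right); traversing
  both of them backwards, as for an arc passing twice through one crossing, does not.

  The virtual crossings newly created by reconnecting the arcs are not recorded, so the result is
  only used for its Gauss diagram, which does not depend on how the loose ends are reconnected.
\<close>

fun reverse_sign :: "'c letter \<Rightarrow> 'c letter" where
  "reverse_sign Bar = Bar"
| "reverse_sign (Classical c ov pos) = Classical c ov (\<not> pos)"
| "reverse_sign (Virtual v l) = Virtual v (\<not> l)"

definition disjoint_arcs :: "word \<Rightarrow> nat letter set \<Rightarrow> bool" where
  "disjoint_arcs w A \<longleftrightarrow> (\<forall>p \<in> A. next_passage w p \<notin> A)"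

definition arc_shift :: "word \<Rightarrow> nat letter set \<Rightarrow> word" where
  "arc_shift w A =
     (let S = A \<union> next_passage w ` A;
          swap = (\<lambda>x. if x \<in> A then next_passage w x
                      else if x \<in> S then prev_passage w x else x);
          resign = (\<lambda>x. if (x \<in> S) \<noteq> (opp x \<in> S) then reverse_sign x else x)
      in map (resign \<circ> swap) w)"

text \<open>
  One arc for each edge on the boundary of the region. If two of these arcs overlapped, shifting
  one would destroy the other, so the move is performed at regions whose arcs are disjoint.
  The result is any plane diagram with the resulting Gauss diagram; all of these are equivalent.
\<close>

definition boundary_arcs :: "(nat letter \<times> bool) set \<Rightarrow> nat letter set" where
  "boundary_arcs R = fst ` R"

definition region_arc_shift_move :: "word rel" where
  "region_arc_shift_move = {(D, D'). D \<in> diagrams \<and> D' \<in> diagrams \<and>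
     (\<exists>R \<in> regions D. disjoint_arcs D (boundary_arcs R) \<and>
        gauss D' = gauss (arc_shift D (boundary_arcs R)))}"

text \<open>
  Least number of moves in \<open>M\<close> which, together with any number of extended Reidemeister moves,
  transform a diagram of \<open>K\<close> into a diagram of a trivial twisted knot (\<open>\<infinity>\<close> if there is none).
\<close>

definition unknotting_number :: "word rel \<Rightarrow> word set \<Rightarrow> enat" where
  "unknotting_number M K =
     (INF n \<in> {n. \<exists>D \<in> K. \<exists>D' \<in> trivial_diagrams.
                    (D, D') \<in> ((diagram_equiv O M) ^^ n) O diagram_equiv}. enat n)"

definition forbidden_number :: "word set \<Rightarrow> enat" where
  "forbidden_number = unknotting_number forbidden_move"

definition region_arc_shift_number :: "word set \<Rightarrow> enat" where
  "region_arc_shift_number = unknotting_number region_arc_shift_move"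

end

theory Submission
  imports Defs
begin

text \<open>
  Every forbidden move is the effect of one region arc shift, up to equivalence. The arcs of a region
  whose boundary passages are pairwise distinct change the sign of each of its crossings twice, so
  the shift only interchanges the two ends of every boundary edge, and an end at a virtual crossing is
  invisible on the Gauss diagram. For \<open>F\<^sub>1\<close>--\<open>F\<^sub>4\<close>, virtual Reidemeister moves make the two passages
  adjacent in the plane diagram and create a triangle whose vertices are their crossings and a virtual
  one. For \<open>T\<^sub>4\<close>, a virtual kink inside the loop of the chord creates a bigon, the shift of which
  moves the chord past the bar, and \<open>R\<^sub>1\<close> removes it. Planarity is kept under control by counting the
  orbits of the face permutation.
\<close>

section \<open>Counting orbits\<close>

text \<open>Diagrams are words satisfying Euler's formula, with no ambient plane in which a strand
  could be rerouted; a diagram with a prescribed Gauss diagram must be exhibited as a word whose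
  faces can be counted. Only two insertions are ever made: a pair of crossings as in a second
  Reidemeister move (2 vertices, 4 edges, 2 faces more) and a kink (1 vertex, 2 edges, 1 face more).
  No crossing is removed. A virtual crossing standing between two passages is cleared by moving the
  classical crossing past it instead: four virtual crossings are added, and one of them exchanges
  its name with the classical one. If the stretch to be cleared crosses itself, this can lengthen
  it, so termination also has to count self-crossings. Virtual insertions are equivalences at no
  cost, because \<open>diagram_equiv\<close> compares Gauss diagrams of members of
  \<open>diagrams\<close>; what remains to be checked for each of them is planarity.\<close>

lemma self_in_orbit_of_inj_on:
  assumes "finite S" "f \<in> S \<rightarrow> S" "inj_on f S" "x \<in> S"
  shows "x \<in> orbit f x"
proof -
  \<comment> \<open>\<open>orbit f x\<close> starts at \<open>f x\<close>, so \<open>x\<close>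
    belongs to it only if the iteration returns. Extending \<open>f\<close> by the identity outside
    \<open>S\<close> gives a permutation of the whole type, where every point returns.\<close>
  define g where "g z = (if z \<in> S then f z else z)" for z
  have "bij_betw f S S"
    using assms endo_inj_surj[of S f] by (auto simp: bij_betw_def)
  then have "bij_betw g S S"
    by (rule bij_betw_cong[THEN iffD1, rotated]) (simp add: g_def)
  then have "g permutes S"
    by (rule bij_imp_permutes) (simp add: g_def)
  with assms(1) have "permutation g"
    by (auto simp: permutation_permutes)
  then have "x \<in> orbit g x"
    by (rule permutation_self_in_orbit)
  moreover have "orbit f x = orbit g x"
    using assms by (intro orbit_cong0[of x S]) (auto simp: g_def)
  ultimately show ?thesis by simp
qed

lemma orbit_eq_of_step:
  assumes "finite S" "f \<in> S \<rightarrow> S" "inj_on f S" "x \<in> S"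
  shows "orbit f (f x) = orbit f x"
  using self_in_orbit_step self_in_orbit_of_inj_on[OF assms] .

lemma orbit_label_eq:
  assumes "f \<in> S \<rightarrow> S" "x \<in> S" "\<And>z. z \<in> S \<Longrightarrow> L (f z) = L z" "y \<in> orbit f x"
  shows "y \<in> S \<and> L y = L x"
  using assms(4) by induction (use assms in auto)

text \<open>A quantity that is constant along orbits and separates them counts them. Faces can thus
  be counted by labelling half-edges, without describing any face as a set.\<close>

lemma card_orbits_eq_card_labels:
  assumes "finite S" "f \<in> S \<rightarrow> S" "inj_on f S"
    and inv: "\<And>x. x \<in> S \<Longrightarrow> L (f x) = L x"
    and sep: "\<And>x y. x \<in> S \<Longrightarrow> y \<in> S \<Longrightarrow> L x = L y \<Longrightarrow> orbit f x = orbit f y"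
  shows "card (orbit f ` S) = card (L ` S)"
proof -
  have self: "x \<in> orbit f x" if "x \<in> S" for x
    using self_in_orbit_of_inj_on assms(1-3) that by metis
  have "L x = L y" if "x \<in> S" "y \<in> S" "orbit f x = orbit f y" for x y
    using orbit_label_eq[of f S x L y] self that assms(2) inv by metis
  with sep have iff: "orbit f x = orbit f y \<longleftrightarrow> L x = L y" if "x \<in> S" "y \<in> S" for x y
    using that by blast
  have "bij_betw (\<lambda>P. L (SOME x. x \<in> S \<and> orbit f x = P)) (orbit f ` S) (L ` S)"
  proof (rule bij_betwI')
    fix P Q assume "P \<in> orbit f ` S" "Q \<in> orbit f ` S"
    then obtain x y where x: "x \<in> S" "P = orbit f x" and y: "y \<in> S" "Q = orbit f y" by auto
    have X: "(SOME z. z \<in> S \<and> orbit f z = P) \<in> S \<and> orbit f (SOME z. z \<in> S \<and> orbit f z = P) = P"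
      by (rule someI[of _ x]) (use x in auto)
    have Y: "(SOME z. z \<in> S \<and> orbit f z = Q) \<in> S \<and> orbit f (SOME z. z \<in> S \<and> orbit f z = Q) = Q"
      by (rule someI[of _ y]) (use y in auto)
    show "L (SOME x. x \<in> S \<and> orbit f x = P) = L (SOME x. x \<in> S \<and> orbit f x = Q) \<longleftrightarrow> P = Q"
      using X Y iff by metis
  next
    fix P assume "P \<in> orbit f ` S"
    then obtain x where x: "x \<in> S" "P = orbit f x" by auto
    have "(SOME z. z \<in> S \<and> orbit f z = P) \<in> S \<and> orbit f (SOME z. z \<in> S \<and> orbit f z = P) = P"
      by (rule someI[of _ x]) (use x in auto)
    then show "L (SOME x. x \<in> S \<and> orbit f x = P) \<in> L ` S" by blast
  next
    fix l assume "l \<in> L ` S"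
    then obtain x where x: "x \<in> S" "l = L x" by auto
    have "(SOME z. z \<in> S \<and> orbit f z = orbit f x) \<in> S
        \<and> orbit f (SOME z. z \<in> S \<and> orbit f z = orbit f x) = orbit f x"
      by (rule someI[of _ x]) (use x in auto)
    then show "\<exists>P\<in>orbit f ` S. l = L (SOME x. x \<in> S \<and> orbit f x = P)"
      using x iff by (intro bexI[of _ "orbit f x"]) auto
  qed
  then show ?thesis by (rule bij_betw_same_card)
qed

text \<open>Applied twice below: with \<open>dart_start\<close>, to replace darts by half-edges, and
  with renamings of crossings.\<close>

lemma card_orbits_conj:
  assumes "f \<in> S \<rightarrow> S" "inj_on k S" "\<And>x. x \<in> S \<Longrightarrow> g (k x) = k (f x)"
  shows "card (orbit g ` k ` S) = card (orbit f ` S)"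
proof -
  have sub: "orbit f x \<subseteq> S" if "x \<in> S" for x
    using orbit_label_eq[of f S x "\<lambda>_. ()"] that assms(1) by auto
  have img: "orbit g (k x) = k ` orbit f x" if x: "x \<in> S" for x
  proof (intro set_eqI iffI)
    fix y assume "y \<in> orbit g (k x)"
    then show "y \<in> k ` orbit f x"
    proof induction
      case base
      then show ?case using assms(3)[OF x] orbit.base[of f x] by simp
    next
      case (step y)
      then obtain z where "z \<in> orbit f x" "y = k z" by auto
      then show ?case using assms(3)[of z] sub[OF x] by (auto intro: orbit.step)
    qed
  next
    fix y assume "y \<in> k ` orbit f x"
    then obtain z where "z \<in> orbit f x" "y = k z" by auto
    moreover from this(1) have "k z \<in> orbit g (k x)"
    proof induction
      case base
      then show ?case using assms(3)[OF x] orbit.base by metis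
    next
      case (step z)
      then show ?case using assms(3)[of z] sub[OF x] by (metis orbit.step subsetD)
    qed
    ultimately show "y \<in> orbit g (k x)" by simp
  qed
  have "orbit g ` k ` S = (\<lambda>A. k ` A) ` (orbit f ` S)"
    using img by (auto simp: image_image)
  moreover have "inj_on (\<lambda>A. k ` A) (orbit f ` S)"
    using sub by (intro inj_onI) (metis (no_types, lifting) assms(2) image_iff inj_on_image_eq_iff)
  ultimately show ?thesis by (simp add: card_image)
qed

lemma orbit_of_involutive_map:
  assumes "f (f x) = x" shows "orbit f x = {x, f x}"
proof
  show "orbit f x \<subseteq> {x, f x}"
  proof
    fix y assume "y \<in> orbit f x" then show "y \<in> {x, f x}"
      by induction (use assms in auto)
  qed
  show "{x, f x} \<subseteq> orbit f x"
    using orbit.base[of f x] orbit.step[OF orbit.base, of f x] assms by auto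
qed

lemma orbit_of_period_three:
  assumes "f (f (f x)) = x" shows "orbit f x = {x, f x, f (f x)}"
proof
  show "orbit f x \<subseteq> {x, f x, f (f x)}"
  proof
    fix y assume "y \<in> orbit f x" then show "y \<in> {x, f x, f (f x)}"
      by induction (use assms in auto)
  qed
  show "{x, f x, f (f x)} \<subseteq> orbit f x"
    using orbit.base[of f x] orbit.step[OF orbit.base, of f x]
      orbit.step[OF orbit.step[OF orbit.base], of f x] assms by auto
qed

text \<open>The combinatorial map of a second Reidemeister move: \<open>E\<close> pairs the two
  halves of an edge, \<open>T\<close> rotates about a vertex, and faces are the orbits of
  \<open>T\<close> after \<open>E\<close>. The strands along \<open>hA\<close> and \<open>hB\<close>
  leave the two ends of the edge of \<open>he\<close> and border the same face there. On each strand
  an unprimed new half-edge looks back to the start and a primed one looks ahead. The equations for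
  \<open>T'\<close> give the two new vertices opposite rotations, since the second crossing undoes
  the first. The two strands may be the two ends of one edge, \<open>E hA = hB\<close>; the ends
  \<open>a2'\<close> and \<open>b2'\<close> are then joined to each other.\<close>

lemma card_orbits_R2:
  fixes E T E' T' :: "'h \<Rightarrow> 'h"
  assumes fin: "finite H"
    and E: "\<And>x. x \<in> H \<Longrightarrow> E x \<in> H" "\<And>x. x \<in> H \<Longrightarrow> E (E x) = x" "\<And>x. x \<in> H \<Longrightarrow> E x \<noteq> x"
    and T: "\<And>x. x \<in> H \<Longrightarrow> T x \<in> H" "inj_on T H" "\<And>x. x \<in> H \<Longrightarrow> T x \<noteq> x"
    and h: "hA \<in> H" "hB \<in> H" "hA \<noteq> hB" "T hA = he" "T (E he) = hB" "he \<noteq> hB"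
    and new: "distinct [a1, a1', a2, a2', b1, b1', b2, b2']"
      "set [a1, a1', a2, a2', b1, b1', b2, b2'] \<inter> H = {}"
      "H' = H \<union> set [a1, a1', a2, a2', b1, b1', b2, b2']"
    and E': "E' hA = a1" "E' a1 = hA" "E' a1' = a2" "E' a2 = a1'"
      "E' hB = b1" "E' b1 = hB" "E' b1' = b2" "E' b2 = b1'"
      "E hA \<noteq> hB \<Longrightarrow> E' a2' = E hA" "E hA \<noteq> hB \<Longrightarrow> E' (E hA) = a2'"
      "E hA \<noteq> hB \<Longrightarrow> E' b2' = E hB" "E hA \<noteq> hB \<Longrightarrow> E' (E hB) = b2'"
      "E hA = hB \<Longrightarrow> E' a2' = b2'" "E hA = hB \<Longrightarrow> E' b2' = a2'"
      "\<And>x. x \<in> H - {hA, hB, E hA, E hB} \<Longrightarrow> E' x = E x"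
    and T': "\<And>x. x \<in> H \<Longrightarrow> T' x = T x"
      "T' a1 = b1'" "T' a1' = b1" "T' a2 = b2" "T' a2' = b2'"
      "T' b1 = a1" "T' b1' = a1'" "T' b2 = a2'" "T' b2' = a2"
  shows "card (orbit (\<lambda>x. T' (E' x)) ` H') = card (orbit (\<lambda>x. T (E x)) ` H) + 2"
proof -
  define f where "f = (\<lambda>x. T (E x))"
  define g where "g = (\<lambda>x. T' (E' x))"
  define N where "N = {a1, a1', a2, a2', b1, b1', b2, b2'}"
  have EA: "E hA \<in> H" "E hB \<in> H" "he \<in> H" "E he \<in> H" using E h T by auto
  have Einj: "x = y" if "x \<in> H" "y \<in> H" "E x = E y" for x y using E that by metis
  have Tinj: "x = y" if "x \<in> H" "y \<in> H" "T x = T y" for x y using T that by (meson inj_onD)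
  have AB: "E hA = hB \<longleftrightarrow> E hB = hA" using E h by metis
  have he: "he \<noteq> hA" "E he \<noteq> hA" "E he \<noteq> hB" "E hA \<noteq> he" "E hB \<noteq> he"
    using E h T EA by metis+
  have H': "H' = H \<union> N" "H \<inter> N = {}" "finite H'" using new fin by (auto simp: N_def)
  note d = new(1)[simplified]
  have dH: "a1 \<notin> H" "a1' \<notin> H" "a2 \<notin> H" "a2' \<notin> H" "b1 \<notin> H" "b1' \<notin> H" "b2 \<notin> H" "b2' \<notin> H"
    using new(2) by auto
  define pA where "pA = E hA"
  define pB where "pB = E hB"
  have p: "pA \<in> H" "pB \<in> H" "E hA = pA" "E hB = pB" "E pA = hA" "E pB = hB"
    "pA \<noteq> hA" "pB \<noteq> hB" "pA \<noteq> pB" "pA = hB \<longleftrightarrow> pB = hA" "pA \<noteq> he" "pB \<noteq> he"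
    using EA E h AB he by (auto simp: pA_def pB_def) metis+
  note E'p = E'(9-15)[folded pA_def pB_def]
  have E'_old: "E' x = E x" "E x \<in> H - {hA, hB, pA, pB}" if "x \<in> H - {hA, hB, pA, pB}" for x
  proof -
    show "E' x = E x" using E'p(7)[OF that] .
    have "E x \<noteq> hA" "E x \<noteq> hB" "E x \<noteq> pA" "E x \<noteq> pB"
      using that E(2)[of x] p by fastforce+
    then show "E x \<in> H - {hA, hB, pA, pB}" using E(1)[of x] that by simp
  qed
  have E'_E': "E' x \<in> H' \<and> E' (E' x) = x" if "x \<in> H'" for x
  proof (cases "x \<in> H - {hA, hB, pA, pB}")
    case True
    then show ?thesis using E'_old[of x] E'_old(1)[of "E x"] E(2)[of x] H'(1) by simp
  next
    case False
    then have "x \<in> {hA, hB, pA, pB, a1, a1', a2, a2', b1, b1', b2, b2'}"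
      using that H' by (auto simp: N_def)
    moreover have "{hA, hB, pA, pB, a1, a1', a2, a2', b1, b1', b2, b2'} \<subseteq> H'"
      using h(1,2) p(1,2) unfolding H'(1) N_def by simp
    moreover have "E' y \<in> {hA, hB, pA, pB, a1, a1', a2, a2', b1, b1', b2, b2'} \<and> E' (E' y) = y"
      if "y \<in> {hA, hB, pA, pB, a1, a1', a2, a2', b1, b1', b2, b2'}" for y
      using that E'(1-8) E'p(1-6) p(10) by (cases "pA = hB") (elim insertE emptyE; simp)+
    ultimately show ?thesis by blast
  qed
  have T'_N: "T' x \<in> N" if "x \<in> N" for x
    using that T'(2-9) unfolding N_def by (elim insertE emptyE; simp)
  have T'_H: "T' x = T x" "T' x \<in> H" if "x \<in> H" for x
    using that T'(1) T(1) by simp_all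
  have T'_H': "T' x \<in> H'" if "x \<in> H'" for x
    using that T'_N[of x] T'_H[of x] unfolding H'(1) by blast
  have T'_inj: "inj_on T' H'"
  proof -
    have "inj_on T' H" using T(2) T'(1) by (simp add: inj_on_def)
    moreover have "inj_on T' N"
      unfolding N_def using d T'(2-9) by (simp add: inj_on_def) metis
    moreover have "T' ` (H - N) \<inter> T' ` (N - H) = {}"
    proof -
      have "T' ` (H - N) \<subseteq> H" "T' ` (N - H) \<subseteq> N"
        using T'_H(2) T'_N by (auto simp only: image_subset_iff Diff_iff)
      with H'(2) show ?thesis by (metis Int_mono subset_empty)
    qed
    ultimately show ?thesis
      unfolding H'(1) inj_on_Un by simp
  qed
  have fS: "f \<in> H \<rightarrow> H" "inj_on f H"
    unfolding f_def inj_on_def using E(1) T(1) Einj Tinj by (simp add: Pi_def, meson)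
  have gS: "g \<in> H' \<rightarrow> H'" "inj_on g H'"
  proof -
    show "g \<in> H' \<rightarrow> H'" using E'_E' T'_H' by (simp add: g_def)
    show "inj_on g H'"
      unfolding g_def using E'_E' T'_inj by (intro inj_onI) (metis inj_onD)
  qed
  have fstep: "orbit f (f x) = orbit f x" if "x \<in> H" for x
    using orbit_eq_of_step[OF fin fS that] .
  have gstep: "orbit g (g x) = orbit g x" if "x \<in> H'" for x
    using orbit_eq_of_step[OF H'(3) gS that] .

  have f: "f he = hB" "f pA = he" "f hA = T pA" "f hB = T pB" "f pB = T hB"
    using h p by (simp_all add: f_def)
  have g_he: "g he = hB"
    using E'_old[of he] EA(3) he p h T'(1)[of "E he"] EA(4) by (simp add: g_def)
  have g1: "g hB = a1" "g a1 = he" "g a1' = b2" "g b2 = a1'" "g hA = b1'" "g b1' = a2'" "g a2 = b1"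
    using E'(1-8) T'(2-9) T'(1)[OF h(1)] h(4) by (simp_all add: g_def)
  have g_b1: "g b1 = f pB"
    using E'(1-8) T'(1)[OF h(2)] f by (simp add: g_def)
  have g2: "g pA = b2'" "g b2' = f hB" "g a2' = f hA" "g pB = a2" if "pA \<noteq> hB"
    using E'p that T' p f by (simp_all add: g_def)
  have g3: "g b2' = b2'" "g a2' = a2" if "pA = hB"
    using E'p that T' by (simp_all add: g_def)
  have g4: "g x = f x" "f x \<noteq> he" "f x \<noteq> hB" "f x \<in> H"
    if "x \<in> H - {he, hA, hB, pA, pB}" for x
  proof -
    have x: "x \<in> H" "x \<noteq> he" "E x \<in> H" "E x \<noteq> hA" "E' x = E x"
      using that E'_old[of x] by auto
    show "g x = f x" "f x \<in> H" using x T'(1) T(1) by (simp_all add: f_def g_def)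
    show "f x \<noteq> he" using Tinj[of "E x" hA] x h by (auto simp: f_def)
    show "f x \<noteq> hB" using Tinj[of "E x" "E he"] Einj[of x he] x h EA by (auto simp: f_def)
  qed

  \<comment> \<open>The old face through \<open>he\<close> and \<open>hB\<close> is cut into the triangle \<open>he, hB, a1\<close> and a face through
    \<open>b2'\<close>; the bigon \<open>a1', b2\<close> is new.\<close>
  define L where "L x = (if x \<in> {he, hB, a1} then Inr True else if x \<in> {a1', b2} then Inr False
     else if x = b2' then Inl (orbit f hB) else if x \<in> {b1', a2'} then Inl (orbit f hA)
     else if x \<in> {a2, b1} then Inl (orbit f pB) else Inl (orbit f x))" for x
  have L_new: "L he = Inr True" "L hB = Inr True" "L a1 = Inr True" "L a1' = Inr False"
      "L b2 = Inr False" "L b2' = Inl (orbit f hB)" "L b1' = Inl (orbit f hA)"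
      "L a2' = Inl (orbit f hA)" "L a2 = Inl (orbit f pB)" "L b1 = Inl (orbit f pB)"
    using d dH EA(3) h(2) unfolding L_def by auto
  have L_old: "L x = Inl (orbit f x)" if "x \<in> H" "x \<noteq> he" "x \<noteq> hB" for x
    using that dH unfolding L_def by auto
  have orb: "orbit f hB = orbit f he" "orbit f he = orbit f pA"
    using fstep[of he] fstep[of pA] EA(3) p(1) f by simp_all
  have fH: "f hA \<in> H" "f hB \<in> H" "f pB \<in> H"
    using f p h T(1) by simp_all
  have ne: "f hB \<noteq> hB" "f pB \<noteq> hB" "f hA \<noteq> he" "f pB \<noteq> he" 
      "f hA \<noteq> hB" "pA \<noteq> hB \<Longrightarrow> f hB \<noteq> he"
  proof -
    have 1: "T x = hB \<Longrightarrow> x \<in> H \<Longrightarrow> E x = he" for x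
      using Tinj[of x "E he"] h(5) EA(3,4) E(2) by simp
    have 2: "T x = he \<Longrightarrow> x \<in> H \<Longrightarrow> x = hA" for x
      using Tinj[of x hA] h(1,4) by simp
    show "f hB \<noteq> hB" "f pB \<noteq> hB" "f hA \<noteq> hB"
      using 1[of pB] 1[of hB] 1[of pA] f(3-5) p h(2,6) he(1) by auto
    show "f hA \<noteq> he" "f pB \<noteq> he" "pA \<noteq> hB \<Longrightarrow> f hB \<noteq> he"
      using 2[of pB] 2[of hB] 2[of pA] f(3-5) p h(2,3) by auto
  qed
  have Linv_he: "L (g he) = L he" and Linv_hB: "L (g hB) = L hB"
    by (simp_all only: g_he g1 L_new)
  have Linv_hA: "L (g hA) = L hA"
    using L_old[OF h(1)] h(3) he(1) by (simp add: g1 L_new)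
  have Linv_pA: "L (g pA) = L pA"
  proof (cases "pA = hB")
    case True
    then show ?thesis using Linv_hB by simp
  next
    case False
    then show ?thesis using L_old[OF p(1) p(11)] orb by (simp add: g2(1) L_new)
  qed
  have Linv_pB: "L (g pB) = L pB"
  proof (cases "pA = hB")
    case True
    then show ?thesis using Linv_hA p(10) by simp
  next
    case False
    then show ?thesis using L_old[OF p(2) p(12) p(8)] by (simp add: g2(4) L_new)
  qed
  have Linv: "L (g x) = L x" if x: "x \<in> H'" for x
  proof -
    consider "x \<in> H - {he, hA, hB, pA, pB}" | "x \<in> {he, hA, hB, pA, pB}" | "x \<in> N"
      using x H'(1) by auto
    then show ?thesis
    proof cases
      case 1
      then show ?thesis using g4[OF 1] fstep[of x] L_old[of x] L_old[of "f x"] by simp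
    next
      case 2
      then show ?thesis
        using Linv_he Linv_hA Linv_hB Linv_pA Linv_pB by (elim insertE emptyE) simp_all
    next
      case 3
      have "L (g a1) = L a1" "L (g a1') = L a1'" "L (g b2) = L b2" "L (g b1') = L b1'"
        "L (g a2) = L a2"
        by (simp_all only: g1 L_new)
      moreover have "L (g b1) = L b1"
        using L_old[OF fH(3) ne(4,2)] fstep[OF p(2)] by (simp only: g_b1 L_new)
      moreover have "L (g b2') = L b2'" "L (g a2') = L a2'"
        using L_old[OF fH(2) _ ne(1)] ne(6) L_old[OF fH(1) ne(3,5)] fstep[OF h(1)] fstep[OF h(2)]
          g2(2,3) g3 L_new p(10) by (cases "pA = hB"; simp)+
      ultimately show ?thesis
        using 3 unfolding N_def by (elim insertE emptyE) simp_all
    qed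
  qed
  \<comment> \<open>\<open>he\<close> and \<open>hB\<close> now lie on the triangle, so their old
    face is represented by \<open>b2'\<close>, which belongs to the rest of it. With this correction
    \<open>orbit g (r x)\<close> is constant along \<open>f\<close>, and this yields that the labels
    separate the new orbits.\<close>
  define r where "r x = (if x = he \<or> x = hB then b2' else x)" for x
  have inH': "hA \<in> H'" "hB \<in> H'" "pA \<in> H'" "pB \<in> H'" "he \<in> H'" "N \<subseteq> H'"
    using H'(1) h p EA by auto
  have gorb: "orbit g hB = orbit g he" "orbit g a1 = orbit g he" "orbit g b2 = orbit g a1'"
    "orbit g b1' = orbit g hA" "orbit g a2' = orbit g hA" "orbit g b1 = orbit g a2"
    "orbit g (f pB) = orbit g a2"
    using gstep[of he] gstep[of hB] gstep[of a1'] gstep[of hA] gstep[of b1'] gstep[of a2]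
      gstep[of b1] g_he g1 g_b1 inH' unfolding N_def by auto
  have gorb1: "orbit g b2' = orbit g pA" "orbit g (f hB) = orbit g b2'" "orbit g (f hA) = orbit g hA"
    "orbit g a2 = orbit g pB" if "pA \<noteq> hB"
    using gstep[of pA] gstep[of b2'] gstep[of a2'] gstep[of pB] g2[OF that] inH' gorb
    unfolding N_def by auto
  have gorb2: "orbit g a2 = orbit g hA" if "pA = hB"
    using gstep[of a2'] g3[OF that] inH' gorb unfolding N_def by auto
  have rstep: "orbit g (r (f x)) = orbit g (r x)" if x: "x \<in> H" for x
  proof (cases "x \<in> {he, hA, hB, pA, pB}")
    case True
    then show ?thesis
      using gorb gorb1 gorb2 f(1,2) ne p h(1,3,6) he(1) unfolding r_def by (cases "pA = hB") auto
  next
    case False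
    then have "x \<in> H - {he, hA, hB, pA, pB}" using x by simp
    from g4[OF this] show ?thesis
      using gstep[of x] x H'(1) False unfolding r_def by simp
  qed
  have r_orbit: "orbit g (r y) = orbit g (r x)" if "x \<in> H" "y \<in> orbit f x" for x y
    using orbit_label_eq[of f H x "\<lambda>x. orbit g (r x)" y] rstep fS(1) that by auto
  have Lrep: "\<exists>y\<in>H. L x = Inl (orbit f y) \<and> orbit g x = orbit g (r y)"
    if "x \<in> H'" "L x \<notin> range Inr" for x
  proof (cases "x \<in> H")
    case True
    then have "x \<noteq> he" "x \<noteq> hB" using that L_new by auto
    then show ?thesis using True L_old[of x] by (intro bexI[of _ x]) (simp_all add: r_def)
  next
    case False
    then have "x \<in> {b1', a2', a2, b1, b2'}"
      using that L_new H'(1) unfolding N_def by auto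
    moreover have "orbit g a2 = orbit g (r pB)"
      using gorb1 gorb2 p he by (auto simp: r_def)
    moreover have "r hA = hA" "r hB = b2'"
      using h(3) he(1) by (simp_all add: r_def)
    ultimately consider
        "L x = Inl (orbit f hA)" "orbit g x = orbit g (r hA)"
      | "L x = Inl (orbit f pB)" "orbit g x = orbit g (r pB)"
      | "L x = Inl (orbit f hB)" "orbit g x = orbit g (r hB)"
      by (elim insertE emptyE) (simp_all add: L_new gorb)
    then show ?thesis using h(1,2) p(2) by cases blast+
  qed
  have sep: "orbit g x = orbit g y" if xy: "x \<in> H'" "y \<in> H'" "L x = L y" for x y
  proof (cases "L x \<in> range Inr")
    case True
    then show ?thesis using xy(3) gorb(1-3) unfolding L_def
      by (auto split: if_splits)
  next
    case False
    then obtain x' y' where "x' \<in> H" "y' \<in> H" "L x = Inl (orbit f x')" "L y = Inl (orbit f y')"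
      "orbit g x = orbit g (r x')" "orbit g y = orbit g (r y')"
      using Lrep[of x] Lrep[of y] xy by metis
    then show ?thesis
      using r_orbit[of x' y'] xy(3) self_in_orbit_of_inj_on[OF fin fS, of y'] by simp
  qed
  have "card (orbit g ` H') = card (L ` H')"
    by (rule card_orbits_eq_card_labels[OF H'(3) gS]) (fact Linv sep)+
  also have "L ` H' = Inl ` (orbit f ` H) \<union> {Inr True, Inr False}"
  proof (intro equalityI subsetI)
    fix l assume "l \<in> L ` H'"
    then obtain x where x: "x \<in> H'" "l = L x" by auto
    show "l \<in> Inl ` (orbit f ` H) \<union> {Inr True, Inr False}"
    proof (cases "L x \<in> range Inr")
      case True
      then obtain b where "L x = Inr b" by auto
      then show ?thesis using x(2) by (cases b) auto
    next
      case False
      then show ?thesis using Lrep[OF x(1)] x(2) by auto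
    qed
  next
    fix l assume "l \<in> Inl ` (orbit f ` H) \<union> {Inr True, Inr False}"
    moreover have "Inl (orbit f x) \<in> L ` H'" if "x \<in> H" for x
    proof (cases "x \<in> {he, hB}")
      case True
      then have "Inl (orbit f x) = L b2'" using L_new orb by auto
      then show ?thesis using inH' by (simp add: N_def)
    next
      case False
      then show ?thesis using L_old[of x] that H'(1) by (metis UnI1 imageI insertCI)
    qed
    moreover have "Inr True = L he" "Inr False = L b2" using L_new by simp_all
    ultimately show "l \<in> L ` H'" using inH' by (auto simp: N_def)
  qed
  also have "card \<dots> = card (orbit f ` H) + 2"
    using fin by (subst card_Un_disjoint) (auto simp: card_image)
  finally show ?thesis by (simp add: f_def g_def)
qed

text \<open>The new vertex has the rotation \<open>a\<close>, \<open>b\<close>, \<open>a'\<close>,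
  \<open>b'\<close>, and the loop joins the neighbours \<open>b\<close> and \<open>a'\<close>, so
  that \<open>a'\<close> alone is a new face. The other corners only subdivide old faces:
  \<open>b\<close> and \<open>b'\<close> come between \<open>h\<close> and its successor,
  \<open>a\<close> between \<open>E h\<close> and its successor.\<close>

lemma card_orbits_kink:
  fixes E T E' T' :: "'h \<Rightarrow> 'h"
  assumes fin: "finite H"
    and E: "\<And>x. x \<in> H \<Longrightarrow> E x \<in> H" "\<And>x. x \<in> H \<Longrightarrow> E (E x) = x" "\<And>x. x \<in> H \<Longrightarrow> E x \<noteq> x"
    and T: "\<And>x. x \<in> H \<Longrightarrow> T x \<in> H" "inj_on T H"
    and h: "h \<in> H"
    and new: "distinct [a, a', b, b']" "set [a, a', b, b'] \<inter> H = {}"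
      "H' = H \<union> set [a, a', b, b']"
    and E': "E' h = a" "E' a = h" "E' a' = b" "E' b = a'" "E' b' = E h" "E' (E h) = b'"
      "\<And>x. x \<in> H - {h, E h} \<Longrightarrow> E' x = E x"
    and T': "\<And>x. x \<in> H \<Longrightarrow> T' x = T x" "T' a = b" "T' a' = b'" "T' b = a'" "T' b' = a"
  shows "card (orbit (\<lambda>x. T' (E' x)) ` H') = card (orbit (\<lambda>x. T (E x)) ` H) + 1"
proof -
  define f where "f = (\<lambda>x. T (E x))"
  define g where "g = (\<lambda>x. T' (E' x))"
  define N where "N = {a, a', b, b'}"
  define k where "k = E h"
  have k: "k \<in> H" "E k = h" "E h = k" "k \<noteq> h" using E h by (simp_all add: k_def)
  have Tinj: "x = y" if "x \<in> H" "y \<in> H" "T x = T y" for x y using T(2) that by (meson inj_onD)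
  have H': "H' = H \<union> N" "H \<inter> N = {}" "finite H'" using new fin by (auto simp: N_def)
  note d = new(1)[simplified]
  have dH: "a \<notin> H" "a' \<notin> H" "b \<notin> H" "b' \<notin> H" using new(2) by auto
  note E'k = E'(5-7)[folded k_def]
  have E_inj: "x = y" if "x \<in> H" "y \<in> H" "E x = E y" for x y using E(2) that by metis
  have fS: "f \<in> H \<rightarrow> H" "inj_on f H"
    unfolding f_def inj_on_def using E(1) T(1) E_inj Tinj by (simp add: Pi_def, meson)
  have f: "f h = T k" "f k = T h" using k by (simp_all add: f_def)
  have fH: "f x \<in> H" if "x \<in> H" for x using that fS(1) by auto
  have g1: "g a' = a'" "g h = b" "g b = b'" "g k = a"
    using E'(1-4) E'k T'(2-5) by (simp_all add: g_def)
  have g2: "g b' = f h" "g a = f k"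
    using E'(1-4) E'k(1,2) T'(1)[OF h] T'(1)[OF k(1)] f by (simp_all add: g_def)
  have g3: "g x = f x" if "x \<in> H" "x \<noteq> h" "x \<noteq> k" for x
    using that E'k(3)[of x] T'(1)[OF E(1), of x] by (simp add: g_def f_def)
  have gS: "g \<in> H' \<rightarrow> H'"
  proof (rule Pi_I)
    fix x assume "x \<in> H'"
    then consider "x = h" | "x = k" | "x \<in> H" "x \<noteq> h" "x \<noteq> k" | "x \<in> N" using H'(1) by auto
    then show "g x \<in> H'"
    proof cases
      case 4
      then show ?thesis using g1 g2 fH h k(1) unfolding H'(1) N_def by auto
    qed (use g1 g3 fH H'(1) N_def in auto)
  qed
  have "H' \<subseteq> g ` H'"
  proof
    fix x assume x: "x \<in> H'"
    show "x \<in> g ` H'"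
    proof (cases "x \<in> H")
      case True
      have "f ` H = H" using fS fin by (metis PiE endo_inj_surj image_subsetI)
      with True obtain y where y: "y \<in> H" "x = f y" by auto
      then have "x = g b'" "x = g a" "x = g y" if "y = h" "y = k" "y \<notin> {h, k}"
        using g2 g3 that by auto
      then show ?thesis using y H'(1) N_def g2 g3 by (metis UnI1 UnI2 image_eqI insertCI)
    next
      case False
      then have "x \<in> {g a', g h, g b, g k}" using x g1 unfolding H'(1) N_def by auto
      then show ?thesis using h k(1) unfolding H'(1) N_def by auto
    qed
  qed
  then have inj: "inj_on g H'"
    using gS H'(3) by (metis eq_card_imp_inj_on image_subset_iff_funcset subset_antisym)
  have fstep: "orbit f (f x) = orbit f x" if "x \<in> H" for x
    using orbit_eq_of_step[OF fin fS that] .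
  have gstep: "orbit g (g x) = orbit g x" if "x \<in> H'" for x
    using orbit_eq_of_step[OF H'(3) gS inj that] .
  define L where "L x = (if x = a' then Inr () else if x \<in> {b, b'} then Inl (orbit f h)
      else if x = a then Inl (orbit f k) else Inl (orbit f x))" for x
  have L_new: "L a' = Inr ()" "L b = Inl (orbit f h)" "L b' = Inl (orbit f h)" "L a = Inl (orbit f k)"
    using d unfolding L_def by auto
  have L_old: "L x = Inl (orbit f x)" if "x \<in> H" for x
    using that dH unfolding L_def by auto
  have Linv: "L (g x) = L x" if x: "x \<in> H'" for x
  proof -
    consider "x = h" | "x = k" | "x \<in> H" "x \<noteq> h" "x \<noteq> k" | "x \<in> N" using x H'(1) by blast
    then show ?thesis
    proof cases
      case 4
      have "L (f h) = L b'" "L (f k) = L a" using L_old fH h k(1) fstep L_new by simp_all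
      then have "L (g a) = L a" "L (g a') = L a'" "L (g b) = L b" "L (g b') = L b'"
        by (simp_all add: g1 g2 L_new)
      then show ?thesis using 4 unfolding N_def by (elim insertE emptyE) simp_all
    qed (use g1 g3 L_new L_old h k(1) fH fstep in simp_all)
  qed
  have inH': "h \<in> H'" "k \<in> H'" "N \<subseteq> H'" using h k H'(1) by auto
  have gorb: "orbit g b = orbit g h" "orbit g b' = orbit g h" "orbit g a = orbit g k"
    "orbit g (f h) = orbit g h" "orbit g (f k) = orbit g k"
    using gstep[of h] gstep[of k] gstep[of b] gstep[of b'] gstep[of a] g1 g2 inH'
    unfolding N_def by auto
  have rstep: "orbit g (f x) = orbit g x" if "x \<in> H" for x
    using gorb(4,5) g3[OF that] gstep[of x] that H'(1) by (cases "x = h \<or> x = k") auto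
  have r_orbit: "orbit g y = orbit g x" if "x \<in> H" "y \<in> orbit f x" for x y
    using orbit_label_eq[of f H x "\<lambda>x. orbit g x" y] rstep fS(1) that by auto
  have Lrep: "\<exists>y\<in>H. L x = Inl (orbit f y) \<and> orbit g x = orbit g y" if x: "x \<in> H'" "x \<noteq> a'" for x
  proof -
    consider "x \<in> H" | "x = a" | "x = b" | "x = b'" using x H'(1) N_def by auto
    then show ?thesis using L_old L_new gorb h k(1) by cases auto
  qed
  have sep: "orbit g x = orbit g y" if xy: "x \<in> H'" "y \<in> H'" "L x = L y" for x y
  proof (cases "x = a' \<or> y = a'")
    case True
    then have "x = y" using L_new(1) Lrep[OF xy(1)] Lrep[OF xy(2)] xy(3) by (metis sum.distinct(1))
    then show ?thesis by simp
  next
    case False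
    then obtain x' y' where "x' \<in> H" "y' \<in> H" "L x = Inl (orbit f x')" "L y = Inl (orbit f y')"
      "orbit g x = orbit g x'" "orbit g y = orbit g y'"
      using Lrep[of x] Lrep[of y] xy by metis
    then show ?thesis
      using r_orbit[of x' y'] xy(3) self_in_orbit_of_inj_on[OF fin fS, of y'] by simp
  qed
  have "card (orbit g ` H') = card (L ` H')"
    by (rule card_orbits_eq_card_labels[OF H'(3) gS inj]) (fact Linv sep)+
  also have "L ` H' = Inl ` (orbit f ` H) \<union> {Inr ()}"
  proof (intro equalityI subsetI)
    fix l assume "l \<in> L ` H'"
    then show "l \<in> Inl ` (orbit f ` H) \<union> {Inr ()}" using L_new(1) Lrep by blast
  next
    fix l assume "l \<in> Inl ` (orbit f ` H) \<union> {Inr ()}"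
    then show "l \<in> L ` H'"
      using L_new(1) L_old inH' H'(1) unfolding N_def by (auto simp: image_iff)
  qed
  also have "card \<dots> = card (orbit f ` H) + 1"
    using fin by (subst card_Un_disjoint) (auto simp: card_image)
  finally show ?thesis by (simp add: f_def g_def)
qed

section \<open>Half-edges of a diagram\<close>

lemma map_of_zip_append_skip: "k \<notin> set xs \<Longrightarrow> map_of (zip xs ys @ ps) k = map_of ps k"
  by (induction xs ys rule: list_induct2') auto

text \<open>The word is cyclic, so what stands before \<open>p\<close> follows after the end; the
  final \<open>[p]\<close> makes the only passage of a word its own successor.\<close>

lemma next_passage_split:
  assumes "passages w = us @ p # vs" "distinct (passages w)"
  shows "next_passage w p = hd (vs @ us @ [p])"
proof (cases us)
  case Nil
  then show ?thesis using assms by (cases vs) (auto simp: next_passage_def)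
next
  case (Cons u us')
  have "p \<notin> set us" using assms by auto
  moreover have "zip (passages w) (rotate1 (passages w)) = zip us (us' @ [p]) @ zip (p # vs) (vs @ [u])"
    using zip_append[of us "us' @ [p]" "p # vs" "vs @ [u]"] assms(1) Cons by simp
  ultimately show ?thesis using Cons by (cases vs) (simp_all add: next_passage_def map_of_zip_append_skip
      del: zip_Cons_Cons map_of_append, simp_all)
qed

lemma prev_passage_split:
  assumes "passages w = us @ q # vs" "distinct (passages w)"
  shows "prev_passage w q = last (q # vs @ us)"
proof (cases us rule: rev_cases)
  case Nil
  obtain vs' v where v: "q # vs = vs' @ [v]" by (metis list.discI rev_exhaust)
  then have len: "length vs = length vs'" by (metis length_Cons length_append_singleton nat.inject)
  have "q \<notin> set vs" using assms by auto
  moreover have "zip (rotate1 (passages w)) (passages w) = zip (vs @ [q]) (vs' @ [v])"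
    using assms(1) Nil v by (metis append_Nil rotate1.simps(2))
  then have "zip (rotate1 (passages w)) (passages w) = zip vs vs' @ [(q, v)]"
    using zip_append[of vs vs' "[q]" "[v]"] len by simp
  ultimately show ?thesis using Nil v by (simp add: prev_passage_def map_of_zip_append_skip del: map_of_append)
next
  case (snoc us' u)
  have q: "q \<notin> set us" using assms by auto
  show ?thesis
  proof (cases us')
    case Nil
    then show ?thesis using snoc assms q by (auto simp: prev_passage_def)
  next
    case (Cons u1 us1)
    have "q \<notin> set (us1 @ [u])" using q snoc Cons by auto
    moreover have "zip (rotate1 (passages w)) (passages w)
        = zip (us1 @ [u]) us' @ zip (q # vs @ [u1]) (u # q # vs)"
      using assms(1) snoc Cons zip_append[of "us1 @ [u]" us' "q # vs @ [u1]" "u # q # vs"] by simp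
    ultimately show ?thesis using snoc Cons by (simp add: prev_passage_def map_of_zip_append_skip del: zip_Cons_Cons map_of_append) simp
  qed
qed

lemma prev_next_passage:
  assumes "p \<in> set (passages w)" "distinct (passages w)"
  shows "prev_passage w (next_passage w p) = p"
    and "next_passage w (prev_passage w p) = p"
    and "next_passage w p \<in> set (passages w)"
    and "prev_passage w p \<in> set (passages w)"
proof -
  obtain us vs where s: "passages w = us @ p # vs" using assms(1) by (auto simp: in_set_conv_decomp)
  note n = next_passage_split[OF s assms(2)] and p = prev_passage_split[OF s assms(2)]
  show "next_passage w p \<in> set (passages w)"
    unfolding n s by (cases vs; cases us) auto
  show "prev_passage w p \<in> set (passages w)"
    unfolding p s by (cases vs rule: rev_cases; cases us rule: rev_cases) auto
  show "prev_passage w (next_passage w p) = p"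
  proof (cases vs)
    case Nil
    show ?thesis
    proof (cases us)
      case (Cons u us')
      then show ?thesis
        using Nil n s prev_passage_split[of w "[]" u "us' @ [p]"] assms(2) by simp
    qed (use Nil n p in simp)
  next
    case (Cons v vs')
    then show ?thesis
      using n s prev_passage_split[of w "us @ [p]" v vs'] assms(2) by simp
  qed
  show "next_passage w (prev_passage w p) = p"
  proof (cases us rule: rev_cases)
    case Nil
    show ?thesis
    proof (cases vs rule: rev_cases)
      case (snoc vs' v)
      then show ?thesis
        using Nil p s next_passage_split[of w "p # vs'" v "[]"] assms(2) by simp
    qed (use Nil n p in simp)
  next
    case (snoc us' u)
    then show ?thesis
      using p s next_passage_split[of w us' u "p # vs"] assms(2) by simp
  qed
qed

text \<open>
  \<open>(p, True)\<close> and \<open>(p, False)\<close> now name the outgoing and the incoming half-edge at the passage \<open>p\<close>.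
  Conjugating \<open>face_step\<close> by \<open>dart_start\<close> makes it the composition of the two maps below, in which
  the orientation of the knot no longer matters.
\<close>

fun edge :: "word \<Rightarrow> nat letter \<times> bool \<Rightarrow> nat letter \<times> bool" where
  "edge w (p, True) = (next_passage w p, False)"
| "edge w (p, False) = (prev_passage w p, True)"

fun turn :: "nat letter \<times> bool \<Rightarrow> nat letter \<times> bool" where
  "turn (p, b) = (opp p, leftward p \<noteq> b)"

fun dart_start :: "word \<Rightarrow> nat letter \<times> bool \<Rightarrow> nat letter \<times> bool" where
  "dart_start w (p, True) = (p, True)"
| "dart_start w (p, False) = (next_passage w p, False)"

text \<open>The part of \<open>well_formed\<close> that makes the face permutation a permutation.
  The remaining part, agreement of signs, can be read off the Gauss diagram and is kept apart, so
  that it transfers along equality of Gauss diagrams while insertions only have to preserve this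
  one.\<close>

definition four_valent :: "word \<Rightarrow> bool" where
  "four_valent w \<longleftrightarrow> distinct (passages w) \<and> (\<forall>p \<in> set (passages w). opp p \<in> set (passages w))"

lemma four_valentD:
  assumes "four_valent w"
  shows "distinct (passages w)" "p \<in> set (passages w) \<Longrightarrow> opp p \<in> set (passages w)"
  using assms by (auto simp: four_valent_def)

lemma opp_opp [simp]: "opp (opp p) = p"
  by (cases p) auto

lemma opp_eq_iff [simp]: "opp p = opp q \<longleftrightarrow> p = q"
  by (metis opp_opp)

lemma not_Bar_in_passages [simp]: "Bar \<notin> set (passages w)"
  by (simp add: passages_def)

lemma opp_neq: "p \<noteq> Bar \<Longrightarrow> opp p \<noteq> p"
  by (cases p) auto

lemma opp_eq_Bar_iff [simp]: "opp p = Bar \<longleftrightarrow> p = Bar"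
  by (cases p) auto

lemma leftward_opp: "p \<noteq> Bar \<Longrightarrow> leftward (opp p) \<longleftrightarrow> \<not> leftward p"
  by (cases p) auto

lemma mem_darts [simp]: "(p, b) \<in> darts w \<longleftrightarrow> p \<in> set (passages w)"
  by (simp add: darts_def)

lemma finite_darts [simp]: "finite (darts w)"
  by (simp add: darts_def)

lemma edge_edge:
  assumes "distinct (passages w)" "h \<in> darts w"
  shows "edge w h \<in> darts w" "edge w (edge w h) = h" "snd (edge w h) \<longleftrightarrow> \<not> snd h"
proof -
  obtain p b where "h = (p, b)" by (cases h)
  then show "edge w h \<in> darts w" "edge w (edge w h) = h" "snd (edge w h) \<longleftrightarrow> \<not> snd h"
    using prev_next_passage[of p w] assms by (cases b; simp)+
qed

lemma edge_neq:
  assumes "distinct (passages w)" "h \<in> darts w"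
  shows "edge w h \<noteq> h"
  using edge_edge(3)[OF assms] by auto

lemma turn_in_darts: "four_valent w \<Longrightarrow> h \<in> darts w \<Longrightarrow> turn h \<in> darts w"
  by (cases h) (auto simp: four_valent_def)

lemma turn_neq: "h \<in> darts w \<Longrightarrow> turn h \<noteq> h"
proof -
  assume "h \<in> darts w"
  then have "fst h \<noteq> Bar" by (auto simp: darts_def)
  then show "turn h \<noteq> h" using opp_neq[of "fst h"] by (cases h) simp
qed

lemma inj_turn: "inj turn"
  by (rule injI) auto

definition faces :: "word \<Rightarrow> (nat letter \<times> bool) set set" where
  "faces w = orbit (\<lambda>h. turn (edge w h)) ` darts w"

text \<open>Regions lie to the left of their darts, and turning left at the end of a dart is the
  clockwise rotation \<open>turn\<close> from the half-edge of arrival. A dart therefore corresponds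
  to the half-edge at its start, in either direction of traversal.\<close>

lemma card_regions:
  assumes w: "four_valent w"
  shows "card (regions w) = card (faces w)"
proof -
  note d = four_valentD(1)[OF w]
  have step: "dart_start w (face_step w h) = turn (edge w (dart_start w h))
      \<and> face_step w h \<in> darts w" if "h \<in> darts w" for h
  proof -
    obtain p b where h: "h = (p, b)" by (cases h)
    then have "p \<in> set (passages w)" using that by simp
    then show ?thesis
      using h prev_next_passage[OF _ d] four_valentD(2)[OF w] by (cases b) (auto simp: Let_def)
  qed
  have inj: "inj_on (dart_start w) (darts w)"
  proof (rule inj_onI)
    fix h k assume "h \<in> darts w" "k \<in> darts w" "dart_start w h = dart_start w k"
    then show "h = k"
      using prev_next_passage(1)[OF _ d] by (cases "(w, h)" rule: dart_start.cases;
        cases "(w, k)" rule: dart_start.cases) (auto, metis)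
  qed
  have "dart_start w ` darts w \<subseteq> darts w"
  proof (intro subsetI)
    fix k assume "k \<in> dart_start w ` darts w"
    then obtain p b where "k = dart_start w (p, b)" "p \<in> set (passages w)" by auto
    then show "k \<in> darts w" using prev_next_passage(3)[OF _ d] by (cases b) auto
  qed
  then have img: "dart_start w ` darts w = darts w"
    using inj finite_darts by (metis endo_inj_surj)
  have "card (orbit (\<lambda>h. turn (edge w h)) ` dart_start w ` darts w) = card (orbit (face_step w) ` darts w)"
    using step by (intro card_orbits_conj inj) auto
  then show ?thesis by (simp add: img faces_def regions_def)
qed

section \<open>Subdividing an edge at one of its half-edges\<close>

definition insert_at :: "'a \<times> bool \<Rightarrow> 'a \<Rightarrow> 'a list \<Rightarrow> 'a list" where
  "insert_at h x w =
     concat (map (\<lambda>z. if z = fst h then if snd h then [z, x] else [x, z] else [z]) w)"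

lemma insert_at_id: "p \<notin> set w \<Longrightarrow> insert_at (p, b) x w = w"
  by (induction w) (auto simp: insert_at_def)

lemma insert_at_append: "insert_at h x (u @ v) = insert_at h x u @ insert_at h x v"
  by (simp add: insert_at_def)

lemma insert_at_split:
  assumes "p \<notin> set us" "p \<notin> set vs"
  shows "insert_at (p, b) x (us @ p # vs) = us @ (if b then [p, x] else [x, p]) @ vs"
  using insert_at_id[OF assms(1)] insert_at_id[OF assms(2)] insert_at_append[of "(p, b)" x us "p # vs"]
    insert_at_append[of "(p, b)" x "[p]" vs] by (simp add: insert_at_def)

lemma passages_append [simp]: "passages (u @ v) = passages u @ passages v"
  by (simp add: passages_def)

lemma passages_Cons [simp]:
  "passages (x # v) = (if x = Bar then passages v else x # passages v)"
  by (simp add: passages_def)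

lemma passages_Nil [simp]: "passages [] = []"
  by (simp add: passages_def)

lemma passages_insert_at:
  assumes "p \<noteq> Bar" "x \<noteq> Bar"
  shows "passages (insert_at (p, b) x w) = insert_at (p, b) x (passages w)"
  using assms by (induction w) (auto simp: insert_at_def)

text \<open>Seen from the half-edge \<open>(p, b)\<close> both orientations look alike:
  \<open>(x, \<not> b)\<close> faces \<open>p\<close>, and \<open>(x, b)\<close> inherits the old
  partner of \<open>(p, b)\<close>. Later insertions can thus ignore the direction in which a strand
  is traversed.\<close>

lemma edge_insert_at:
  fixes b :: bool
  assumes dist: "distinct (passages w)" and p: "p \<in> set (passages w)"
    and x: "x \<notin> set (passages w)" "x \<noteq> Bar"
  defines "w' \<equiv> insert_at (p, b) x w"
  shows "distinct (passages w')" "set (passages w') = insert x (set (passages w))"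
    "length (passages w') = Suc (length (passages w))"
    "edge w' (p, b) = (x, \<not> b)" "edge w' (x, \<not> b) = (p, b)" "edge w' (x, b) = edge w (p, b)"
    "edge w' (edge w (p, b)) = (x, b)"
    "h \<in> darts w \<Longrightarrow> h \<noteq> (p, b) \<Longrightarrow> h \<noteq> edge w (p, b) \<Longrightarrow> edge w' h = edge w h"
proof -
  obtain us vs where s: "passages w = us @ p # vs" using p by (auto simp: in_set_conv_decomp)
  have pB: "p \<noteq> Bar" using p by auto
  have notin: "p \<notin> set us" "p \<notin> set vs" using dist s by auto
  have s': "passages w' = us @ (if b then [p, x] else [x, p]) @ vs"
    unfolding w'_def passages_insert_at[OF pB x(2)] s using insert_at_split[OF notin] .
  show d': "distinct (passages w')" and set': "set (passages w') = insert x (set (passages w))"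
    and "length (passages w') = Suc (length (passages w))"
    using dist s x unfolding s' by (auto split: if_splits)
  note nxt = next_passage_split[OF _ dist] next_passage_split[OF _ d']
  have next_True: "next_passage w' y = next_passage w y" if y: "b" "y \<in> set (passages w)" "y \<noteq> p" for y
  proof -
    consider "y \<in> set us" | "y \<in> set vs" using y s by auto
    then show ?thesis
    proof cases
      case 1
      then obtain u1 u2 where u: "us = u1 @ y # u2" by (auto simp: in_set_conv_decomp)
      then show ?thesis
        using nxt(1)[of u1 y "u2 @ p # vs"] nxt(2)[of u1 y "u2 @ p # x # vs"] s s' y(1) u
        by (cases u2) simp_all
    next
      case 2
      then obtain u1 u2 where u: "vs = u1 @ y # u2" by (auto simp: in_set_conv_decomp)
      then show ?thesis
        using nxt(1)[of "us @ p # u1" y u2] nxt(2)[of "us @ p # x # u1" y u2] s s' y(1) u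
        by (cases u2; cases us) simp_all
    qed
  qed
  have next_True': "next_passage w' p = x" "next_passage w' x = next_passage w p" if b
    using that nxt(1)[OF s] nxt(2)[of us p "x # vs"] nxt(2)[of "us @ [p]" x vs] s'
    by (cases vs; cases us; simp)+
  \<comment> \<open>Inserting in front of \<open>p\<close> changes the successor of whichever
    passage came before \<open>p\<close>; this is \<open>p\<close> itself if there is no other
    passage.\<close>
  have next_False: "next_passage w' y = (if next_passage w y = p then x else next_passage w y)"
    if y: "\<not> b" "y \<in> set (passages w)" for y
  proof -
    consider "y \<in> set us" | "y \<in> set vs" | "y = p" using y s by auto
    then show ?thesis
    proof cases
      case 1
      then obtain u1 u2 where u: "us = u1 @ y # u2" by (auto simp: in_set_conv_decomp)
      then show ?thesis
        using nxt(1)[of u1 y "u2 @ p # vs"] nxt(2)[of u1 y "u2 @ x # p # vs"] s s' y(1) u notin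
        by (cases u2) auto
    next
      case 2
      then obtain u1 u2 where u: "vs = u1 @ y # u2" by (auto simp: in_set_conv_decomp)
      then show ?thesis
        using nxt(1)[of "us @ p # u1" y u2] nxt(2)[of "us @ x # p # u1" y u2] s s' y(1) u notin
        by (cases u2; cases us) auto
    next
      case 3
      then show ?thesis
        using nxt(1)[OF s] nxt(2)[of "us @ [x]" p vs] s' y(1) notin
        by (cases vs; cases us) auto
    qed
  qed
  have next_False': "next_passage w' x = p" if "\<not> b"
    using that nxt(2)[of us x "p # vs"] s' by simp
  have sub: "y \<in> set (passages w')" if "y \<in> set (passages w)" for y using that set' by simp
  have x': "x \<in> set (passages w')" using set' by simp
  note pn = prev_next_passage[OF _ dist] and pn' = prev_next_passage[OF _ d']
  \<comment> \<open>\<open>prev_passage\<close> is the inverse of \<open>next_passage\<close>, so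
    the successors computed above determine it.\<close>
  have prev': "prev_passage w' z = y" if "y \<in> set (passages w')" "next_passage w' y = z" for y z
    using pn'(1)[OF that(1)] that(2) by simp
  show "edge w' (p, b) = (x, \<not> b)"
    using next_True'(1) next_False' prev'[OF x'] by (cases b) auto
  show "edge w' (x, \<not> b) = (p, b)"
    using next_True'(1) next_False' prev'[OF sub[OF p]] by (cases b) auto
  show "edge w' (x, b) = edge w (p, b)"
    using next_True'(2) prev'[OF sub[OF pn(4)[OF p]]] next_False[OF _ pn(4)[OF p]] pn(2)[OF p]
    by (cases b) auto
  then have "edge w' (edge w (p, b)) = edge w' (edge w' (x, b))" by simp
  then show "edge w' (edge w (p, b)) = (x, b)"
    using edge_edge(2)[OF d', of "(x, b)"] x' by simp
  assume h: "h \<in> darts w" "h \<noteq> (p, b)" "h \<noteq> edge w (p, b)"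
  obtain y c where y: "h = (y, c)" "y \<in> set (passages w)" using h(1) by (cases h) auto
  show "edge w' h = edge w h"
  proof (cases c)
    case True
    then show ?thesis
      using next_True[OF _ y(2)] next_False[OF _ y(2)] h(2,3) y pn(1)[OF y(2)] by (cases b) auto
  next
    case False
    have "prev_passage w y \<noteq> p" if b
      using pn(2)[OF y(2)] h(3) y(1) False that by auto
    then have "next_passage w' (prev_passage w y) = y"
      using next_True[OF _ pn(4)[OF y(2)]] next_False[OF _ pn(4)[OF y(2)]] pn(2)[OF y(2)] h(2,3) y False
      by (cases b) auto
    then show ?thesis using prev'[OF sub[OF pn(4)[OF y(2)]]] y(1) False by simp
  qed
qed

section \<open>Planar insertion of crossings\<close>

lemma planar_iff_faces:
  assumes "four_valent w"
  shows "planar w \<longleftrightarrow> passages w = [] \<or>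
    length (passages w) div 2 + card (faces w) = length (passages w) + 2"
  using card_regions[OF assms] by (simp add: planar_def)

lemma virtual_in_passages: "Virtual n l \<in> set (passages w) \<longleftrightarrow> Virtual n l \<in> set w"
  by (simp add: passages_def)

text \<open>
  Creates the virtual crossings \<open>n\<close>, \<open>m\<close> between the strands leaving along two half-edges, with \<open>n\<close>
  nearer to the starting points of both.
\<close>

definition virtual_R2 :: "nat \<Rightarrow> nat \<Rightarrow> nat letter \<Rightarrow> bool \<Rightarrow> nat letter \<Rightarrow> bool \<Rightarrow> word \<Rightarrow> word" where
  "virtual_R2 n m p a q b w =
     insert_at (q, b) (Virtual n (a \<noteq> b)) (insert_at (q, b) (Virtual m (a = b))
       (insert_at (p, a) (Virtual n (a = b)) (insert_at (p, a) (Virtual m (a \<noteq> b)) w)))"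

text \<open>The hypothesis \<open>face\<close> says that the two strands leave the ends of one edge
  into a common face, where one can be pulled over the other. The values \<open>a = b\<close> and
  \<open>a \<noteq> b\<close> carried by the new passages are forced by the rotations in
  \<open>card_orbits_R2\<close>; on each strand they differ between \<open>n\<close> and
  \<open>m\<close> because the crossing at \<open>m\<close> leads back. The edges next to
  \<open>n\<close> are recorded in the conclusion so that a further pair can be inserted
  there.\<close>

lemma virtual_R2:
  assumes w: "four_valent w"
    and pq: "p \<in> set (passages w)" "q \<in> set (passages w)" "p \<noteq> q" "opp p \<noteq> q"
    and face: "turn (edge w (turn (p, a))) = (q, b)"
    and fresh: "n \<noteq> m" "\<And>l. Virtual n l \<notin> set w" "\<And>l. Virtual m l \<notin> set w"
  defines "w' \<equiv> virtual_R2 n m p a q b w"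
  shows "four_valent w'" "planar w \<Longrightarrow> planar w'"
    "set (passages w') = set (passages w) \<union> {Virtual n True, Virtual n False, Virtual m True, Virtual m False}"
    "edge w' (p, a) = (Virtual n (a = b), \<not> a)" "edge w' (Virtual n (a = b), \<not> a) = (p, a)"
    "edge w' (q, b) = (Virtual n (a \<noteq> b), \<not> b)" "edge w' (Virtual n (a \<noteq> b), \<not> b) = (q, b)"
    "h \<in> darts w - {(p, a), (q, b), edge w (p, a), edge w (q, b)} \<Longrightarrow> edge w' h = edge w h"
proof -
  define A1 A2 B1 B2 where v: "A1 = Virtual n (a = b)" "A2 = Virtual m (a \<noteq> b)"
    "B1 = Virtual n (a \<noteq> b)" "B2 = Virtual m (a = b)"
  note d = four_valentD(1)[OF w]
  have new: "A1 \<notin> set (passages w)" "A2 \<notin> set (passages w)"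
    "B1 \<notin> set (passages w)" "B2 \<notin> set (passages w)"
    using fresh(2,3) by (simp_all add: v virtual_in_passages)
  have nB: "A1 \<noteq> Bar" "A2 \<noteq> Bar" "B1 \<noteq> Bar" "B2 \<noteq> Bar" by (simp_all add: v)
  have vd: "distinct [A1, A2, B1, B2]" using fresh(1) by (auto simp: v)
  have opps: "opp A1 = B1" "opp A2 = B2" "opp B1 = A1" "opp B2 = A2" by (auto simp: v)
  have hA: "(p, a) \<in> darts w" and hB: "(q, b) \<in> darts w" using pq by simp_all
  define P Q where PQ: "P = edge w (p, a)" "Q = edge w (q, b)"
  have PQ_in: "P \<in> darts w" "Q \<in> darts w" and PQ_back: "edge w P = (p, a)" "edge w Q = (q, b)"
    using edge_edge[OF d hA] edge_edge[OF d hB] by (simp_all add: PQ)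
  have PQ_eq: "P = (q, b) \<longleftrightarrow> Q = (p, a)"
    using PQ_back PQ by metis
  have PQ_neq: "P \<noteq> (p, a)" "Q \<noteq> (q, b)" "P \<noteq> Q"
    using PQ edge_neq[OF d hA] edge_neq[OF d hB] pq(3) PQ_back by auto
  have fstPQ: "fst P \<in> set (passages w)" "fst Q \<in> set (passages w)"
    using PQ_in by (auto simp: darts_def)
  have fst_neq: "fst x \<noteq> A1" "fst x \<noteq> A2" "fst x \<noteq> B1" "fst x \<noteq> B2" if "x \<in> darts w" for x
    using that new by (auto simp: darts_def)
  have pair_neq: "x \<noteq> (A1, c)" "x \<noteq> (A2, c)" "x \<noteq> (B1, c)" "x \<noteq> (B2, c)" if "x \<in> darts w" for x c
    using that new by auto
  have neq: "p \<noteq> A1" "p \<noteq> A2" "p \<noteq> B1" "p \<noteq> B2" "q \<noteq> A1" "q \<noteq> A2" "q \<noteq> B1" "q \<noteq> B2"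
    using new pq by auto

  define w1 where "w1 = insert_at (p, a) A2 w"
  note e1 = edge_insert_at[where b = a, OF d pq(1) new(2) nB(2), folded w1_def]
  define w2 where "w2 = insert_at (p, a) A1 w1"
  have "p \<in> set (passages w1)" "A1 \<notin> set (passages w1)" using e1(2) pq new vd by auto
  note e2 = edge_insert_at[where b = a, OF e1(1) this nB(1), folded w2_def]
  define w3 where "w3 = insert_at (q, b) B2 w2"
  have "q \<in> set (passages w2)" "B2 \<notin> set (passages w2)" using e1(2) e2(2) pq new vd by auto
  note e3 = edge_insert_at[where b = b, OF e2(1) this nB(4), folded w3_def]
  have "q \<in> set (passages w3)" "B1 \<notin> set (passages w3)" using e1(2) e2(2) e3(2) pq new vd by auto
  note e4 = edge_insert_at[where b = b, OF e3(1) this nB(3)]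
  have w': "w' = insert_at (q, b) B1 w3"
    by (simp add: w'_def virtual_R2_def w1_def w2_def w3_def v)
  note e4 = e4[folded w']

  have in1: "x \<in> darts w1 \<longleftrightarrow> fst x = A2 \<or> x \<in> darts w" for x
    using e1(2) by (cases x) simp
  have in2: "x \<in> darts w2 \<longleftrightarrow> fst x = A1 \<or> fst x = A2 \<or> x \<in> darts w" for x
    using e1(2) e2(2) by (cases x) simp
  have in3: "x \<in> darts w3 \<longleftrightarrow> fst x = B2 \<or> fst x = A1 \<or> fst x = A2 \<or> x \<in> darts w" for x
    using e1(2) e2(2) e3(2) by (cases x) simp

  have f2: "edge w2 (p, a) = (A1, \<not> a)" "edge w2 (A1, \<not> a) = (p, a)"
    "edge w2 (A1, a) = (A2, \<not> a)" "edge w2 (A2, \<not> a) = (A1, a)"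
    using e2(4-7) e1(4) by simp_all
  have f2P: "edge w2 (A2, a) = P" "edge w2 P = (A2, a)"
    using e2(8)[of "(A2, a)"] e2(8)[of P] e1(4,6,7) neq PQ_neq(1) in1 PQ_in fst_neq[of P] pair_neq[OF PQ_in(1)]
    by (auto simp: PQ)
  have f2x: "edge w2 x = edge w x" if "x \<in> darts w" "x \<noteq> (p, a)" "x \<noteq> P" for x
    using e2(8)[of x] e1(8)[of x] e1(4) that in1 fst_neq[of x] pair_neq[of x] by (auto simp: PQ)
  \<comment> \<open>If both strands belong to one edge, the insertions on the first strand have
    already cut it, and \<open>(q, b)\<close> now faces \<open>(A2, a)\<close> instead of
    \<open>(p, a)\<close>.\<close>
  define Q' where "Q' = (if P = (q, b) then (A2, a) else Q)"
  have Q': "edge w2 (q, b) = Q'" "edge w2 Q' = (q, b)"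
    using f2P f2x[OF hB] f2x[OF PQ_in(2)] pq(3) PQ PQ_eq PQ_neq PQ_back
    by (auto simp: Q'_def)
  have Q'_neq: "Q' \<noteq> (q, b)" using PQ_neq neq by (auto simp: Q'_def)
  have Q'_in2: "Q' \<in> darts w2" using PQ_in by (auto simp: Q'_def in2)
  then have Q'_fst: "fst Q' \<noteq> B1" "fst Q' \<noteq> B2"
    using in2 fst_neq[of Q'] vd by auto
  have Q'_pair: "Q' \<noteq> (B1, c)" "Q' \<noteq> (B2, c)" for c
    using Q'_fst by auto
  have Q'_cases: "Q' \<noteq> (A1, x)" "Q' \<noteq> (A2, \<not> a)" for x
    using PQ_in(2) fst_neq[of Q] vd by (auto simp: Q'_def)
  have f4: "edge w' (q, b) = (B1, \<not> b)" "edge w' (B1, \<not> b) = (q, b)"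
    "edge w' (B1, b) = (B2, \<not> b)" "edge w' (B2, \<not> b) = (B1, b)"
    using e4(4-7) e3(4) by simp_all
  have f4Q: "edge w' (B2, b) = Q'" "edge w' Q' = (B2, b)"
    using e4(8)[of "(B2, b)"] e4(8)[of Q'] e3(4,6,7) neq Q'_neq in3[of Q'] in3[of "(B2, b)"]
      Q'_in2 in2[of Q'] Q'_fst Q'_pair Q' vd
    by auto
  have f4x: "edge w' x = edge w2 x" if "x \<in> darts w2" "x \<noteq> (q, b)" "x \<noteq> Q'" for x
  proof -
    have "fst x \<noteq> B1" "fst x \<noteq> B2" using that(1) in2 fst_neq[of x] vd by auto
    then have "x \<noteq> edge w3 (q, b)" using e3(4) by auto
    then show ?thesis using e4(8)[of x] e3(8)[of x] that in2 in3 Q' by auto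
  qed
  have darts_A: "(A1, x) \<in> darts w2" "(A2, x) \<in> darts w2" for x by (simp_all add: in2)
  have hA2: "(p, a) \<in> darts w2" "P \<in> darts w2" using hA PQ_in by (simp_all add: in2)
  have pa: "(p, a) \<noteq> Q'" if "P \<noteq> (q, b)" using that PQ_eq by (auto simp: Q'_def)
  have pa2: "(p, a) \<noteq> Q'" using pa neq by (cases "P = (q, b)") (auto simp: Q'_def)

  have E': "edge w' (p, a) = (A1, \<not> a)" "edge w' (A1, \<not> a) = (p, a)"
    "edge w' (A1, a) = (A2, \<not> a)" "edge w' (A2, \<not> a) = (A1, a)"
    using f4x[OF hA2(1)] f4x[OF darts_A(1)] f4x[OF darts_A(2)] f2 pq(3) pa2 neq Q'_cases Q'_cases[symmetric] by auto
  have E'_P: "edge w' (A2, a) = P" "edge w' P = (A2, a)" "edge w' (B2, b) = Q" "edge w' Q = (B2, b)"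
    if "P \<noteq> (q, b)"
  proof -
    have "Q' = Q" using that by (simp add: Q'_def)
    then show "edge w' (A2, a) = P" "edge w' P = (A2, a)" "edge w' (B2, b) = Q" "edge w' Q = (B2, b)"
      using f4x[OF hA2(2)] f4x[OF darts_A(2)] f2P f4Q that PQ_neq(3) neq pair_neq(2)[OF PQ_in(2), symmetric] by auto
  qed
  have E'_P': "edge w' (A2, a) = (B2, b)" "edge w' (B2, b) = (A2, a)" if "P = (q, b)"
    using f4Q that by (simp_all add: Q'_def)
  have E'_old: "edge w' x = edge w x" if "x \<in> darts w - {(p, a), (q, b), P, Q}" for x
  proof -
    have "x \<noteq> Q'" using that fst_neq[of x] by (auto simp: Q'_def)
    then show ?thesis using f4x[of x] f2x[of x] that by (simp add: in2)
  qed
  show setp: "set (passages w') = set (passages w) \<union> {Virtual n True, Virtual n False, Virtual m True, Virtual m False}"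
    using e1(2) e2(2) e3(2) e4(2) by (auto simp: v)
  have setp': "set (passages w') = set (passages w) \<union> {A1, A2, B1, B2}"
    using e1(2) e2(2) e3(2) e4(2) by auto
  show w'4: "four_valent w'"
    unfolding four_valent_def using e4(1) setp four_valentD(2)[OF w] by auto
  show "edge w' (p, a) = (Virtual n (a = b), \<not> a)" "edge w' (Virtual n (a = b), \<not> a) = (p, a)"
    "edge w' (q, b) = (Virtual n (a \<noteq> b), \<not> b)" "edge w' (Virtual n (a \<noteq> b), \<not> b) = (q, b)"
    using E'(1,2) f4(1,2) by (simp_all add: v)
  show "edge w' h = edge w h" if "h \<in> darts w - {(p, a), (q, b), edge w (p, a), edge w (q, b)}"
    using E'_old that by (simp add: PQ)
  have len: "length (passages w') = length (passages w) + 4"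
    using e1(3) e2(3) e3(3) e4(3) by simp
  have darts': "darts w' = darts w \<union> set [(A1, \<not> a), (A1, a), (A2, \<not> a), (A2, a), (B1, \<not> b), (B1, b), (B2, \<not> b), (B2, b)]"
    unfolding darts_def setp' by auto
  have "card (faces w') = card (faces w) + 2"
    unfolding faces_def
  proof (rule card_orbits_R2[where E = "edge w" and T = turn and E' = "edge w'" and T' = turn
      and hA = "(p, a)" and hB = "(q, b)" and he = "turn (p, a)"
      and ?a1.0 = "(A1, \<not> a)" and a1' = "(A1, a)" and ?a2.0 = "(A2, \<not> a)" and a2' = "(A2, a)"
      and ?b1.0 = "(B1, \<not> b)" and b1' = "(B1, b)" and ?b2.0 = "(B2, \<not> b)" and b2' = "(B2, b)"])
    show "finite (darts w)" by simp
    show "edge w x \<in> darts w" "edge w (edge w x) = x" "edge w x \<noteq> x" "turn x \<in> darts w" "turn x \<noteq> x"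
      if "x \<in> darts w" for x
      using that edge_edge[OF d] edge_neq[OF d] turn_in_darts[OF w] turn_neq by auto
    show "inj_on turn (darts w)" using inj_turn by (rule inj_on_subset) simp
    show "turn (p, a) \<noteq> (q, b)" "turn (edge w (turn (p, a))) = (q, b)" using pq(4) face by auto
    show "distinct [(A1, \<not> a), (A1, a), (A2, \<not> a), (A2, a), (B1, \<not> b), (B1, b), (B2, \<not> b), (B2, b)]"
      using vd by auto
    show "set [(A1, \<not> a), (A1, a), (A2, \<not> a), (A2, a), (B1, \<not> b), (B1, b), (B2, \<not> b), (B2, b)] \<inter> darts w = {}"
      using new by auto
    show "(p, a) \<noteq> (q, b)" using pq(3) by simp
    show "turn (A1, \<not> a) = (B1, b)" "turn (A1, a) = (B1, \<not> b)"
      "turn (A2, \<not> a) = (B2, \<not> b)" "turn (A2, a) = (B2, b)"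
      "turn (B1, \<not> b) = (A1, \<not> a)" "turn (B1, b) = (A1, a)"
      "turn (B2, \<not> b) = (A2, a)" "turn (B2, b) = (A2, \<not> a)"
      by (auto simp: v)
  qed (use hA hB darts' E' f4 E'_P E'_P' E'_old in \<open>simp_all add: PQ\<close>)
  then show "planar w \<Longrightarrow> planar w'"
    unfolding planar_iff_faces[OF w] planar_iff_faces[OF w'4] len using pq(1) by auto
qed

lemma planar_kink:
  fixes b :: bool
  assumes w: "four_valent w" "planar w" and p: "p \<in> set (passages w)"
    and x: "x \<noteq> Bar" "x \<notin> set (passages w)" "opp x \<notin> set (passages w)"
  defines "w' \<equiv> insert_at (p, b) x (insert_at (p, b) (opp x) w)"
  shows "four_valent w' \<and> planar w'"
proof -
  note d = four_valentD(1)[OF w(1)]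
  have hp: "(p, b) \<in> darts w" using p by simp
  define P where "P = edge w (p, b)"
  have P: "P \<in> darts w" "edge w P = (p, b)" "P \<noteq> (p, b)" "snd P \<longleftrightarrow> \<not> b"
    using edge_edge[OF d hp] edge_neq[OF d hp] by (simp_all add: P_def)
  define y where "y = opp x"
  have y: "y \<noteq> Bar" "y \<noteq> x" "y \<notin> set (passages w)" "opp x = y" "opp y = x"
    using x opp_neq[of x] by (auto simp: y_def)
  define w1 where "w1 = insert_at (p, b) y w"
  note e1 = edge_insert_at[where b = b, OF d p y(3,1), folded w1_def]
  have "p \<in> set (passages w1)" "x \<notin> set (passages w1)" using e1(2) p x y by auto
  note e2 = edge_insert_at[where b = b, OF e1(1) this x(1)]
  have w': "w' = insert_at (p, b) x w1" by (simp add: w'_def w1_def y_def)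
  note e2 = e2[folded w']
  have in1: "h \<in> darts w1 \<longleftrightarrow> fst h = y \<or> h \<in> darts w" for h
    using e1(2) by (cases h) simp
  have fst_neq: "fst h \<noteq> x" "fst h \<noteq> y" if "h \<in> darts w" for h
    using that x y by (auto simp: darts_def)
  have py: "p \<noteq> y" "p \<noteq> x" using p x y by auto
  have E: "edge w' (p, b) = (x, \<not> b)" "edge w' (x, \<not> b) = (p, b)"
    "edge w' (x, b) = (y, \<not> b)" "edge w' (y, \<not> b) = (x, b)"
    using e2(4-7) e1(4) by simp_all
  have EP: "edge w' (y, b) = P" "edge w' P = (y, b)"
    using e2(8)[of "(y, b)"] e2(8)[of P] e1(4,6,7) py P in1 fst_neq[of P] by (auto simp: P_def)
  have Ex: "edge w' h = edge w h" if "h \<in> darts w - {(p, b), P}" for h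
  proof -
    have "h \<noteq> (y, c)" for c using that fst_neq(2)[of h] by auto
    then show ?thesis using e2(8)[of h] e1(8)[of h] e1(4) that by (auto simp: P_def darts_def e1(2))
  qed
  have setp: "set (passages w') = set (passages w) \<union> {x, y}"
    using e1(2) e2(2) by auto
  have w'4: "four_valent w'"
    unfolding four_valent_def using e2(1) setp four_valentD(2)[OF w(1)] y by auto
  have len: "length (passages w') = length (passages w) + 2"
    using e1(3) e2(3) by simp
  have darts': "darts w' = darts w \<union> {(x, \<not> b), (x, b), (y, \<not> b), (y, b)}"
    unfolding darts_def setp by auto
  have lw: "leftward y \<longleftrightarrow> \<not> leftward x" using leftward_opp[OF x(1)] y by simp
  have D: "edge w h \<in> darts w" "edge w (edge w h) = h" "edge w h \<noteq> h" "turn h \<in> darts w"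
    if "h \<in> darts w" for h
    using that edge_edge[OF d] edge_neq[OF d] turn_in_darts[OF w(1)] by auto
  have inj: "inj_on turn (darts w)" using inj_turn by (rule inj_on_subset) simp
  have "card (faces w') = card (faces w) + 1"
  proof (cases "leftward x")
    case False
    show ?thesis
      unfolding faces_def
    proof (rule card_orbits_kink[where E = "edge w" and T = turn and E' = "edge w'" and T' = turn
        and h = "(p, b)" and a = "(x, \<not> b)" and a' = "(x, b)"
        and b = "(y, \<not> b)" and b' = "(y, b)"])
    qed (use False D inj hp darts' E EP Ex y x lw in \<open>auto simp: P_def\<close>)
  next
    case True
    \<comment> \<open>A kink curling to the other side is the same configuration read from the other
      end \<open>P\<close> of the edge; the two new passages change roles.\<close>
    show ?thesis
      unfolding faces_def
    proof (rule card_orbits_kink[where E = "edge w" and T = turn and E' = "edge w'" and T' = turn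
        and h = P and a = "(y, b)" and a' = "(y, \<not> b)"
        and b = "(x, b)" and b' = "(x, \<not> b)"])
    qed (use True D inj hp P darts' E EP Ex y x lw in auto)
  qed
  moreover have "passages w \<noteq> []" using p by auto
  ultimately show ?thesis
    using w w'4 unfolding planar_iff_faces[OF w(1)] planar_iff_faces[OF w'4] len by simp
qed

section \<open>Diagrams with the same Gauss diagram\<close>

text \<open>Regions are built from passages alone, so bars may be moved or inserted anywhere without
  affecting planarity.\<close>

lemma planar_cong:
  assumes "passages w = passages w'"
  shows "planar w \<longleftrightarrow> planar w'"
proof -
  have "face_step w h = face_step w' h" for h
    using assms by (cases "(w, h)" rule: face_step.cases)
      (auto simp: next_passage_def prev_passage_def Let_def)
  then have "face_step w = face_step w'" by (rule ext)
  then show ?thesis using assms by (simp add: planar_def regions_def darts_def)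
qed

lemma four_valent_cong: "passages w = passages w' \<Longrightarrow> four_valent w \<longleftrightarrow> four_valent w'"
  by (simp add: four_valent_def)

section \<open>Gauss words and their lifts to diagrams\<close>

lemma gauss_append [simp]: "gauss (u @ v) = gauss u @ gauss v"
  by (simp add: gauss_def)

lemma gauss_Cons [simp]: "gauss (x # v) = (if is_virtual x then gauss v else x # gauss v)"
  by (simp add: gauss_def)

lemma gauss_Nil [simp]: "gauss [] = []"
  by (simp add: gauss_def)

lemma set_gauss: "set (gauss w) = {x \<in> set w. \<not> is_virtual x}"
  by (auto simp: gauss_def)

definition consistent_signs :: "word \<Rightarrow> bool" where
  "consistent_signs w \<longleftrightarrow> (\<forall>c ov pos ov' pos'.
     Classical c ov pos \<in> set w \<and> Classical c ov' pos' \<in> set w \<longrightarrow> pos = pos')"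

lemma well_formed_iff: "well_formed w \<longleftrightarrow> four_valent w \<and> consistent_signs (gauss w)"
  by (auto simp: well_formed_def four_valent_def consistent_signs_def set_gauss)

lemma diagrams_iff: "w \<in> diagrams \<longleftrightarrow> four_valent w \<and> consistent_signs (gauss w) \<and> planar w"
  by (simp add: diagrams_def well_formed_iff)

lemma is_virtual_opp [simp]: "is_virtual (opp x) = is_virtual x"
  by (cases x) auto

lemma passages_gauss: "passages (gauss w) = gauss (passages w)"
  by (induction w) auto

lemma gauss_diagram_gauss:
  assumes "four_valent w" "consistent_signs (gauss w)"
  shows "gauss_diagram (gauss w)"
proof -
  have "gauss (gauss w) = gauss w" by (simp add: gauss_def)
  moreover have "four_valent (gauss w)"
    using assms(1) unfolding four_valent_def passages_gauss
    by (auto simp: gauss_def)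
  ultimately show ?thesis
    using assms(2) by (auto simp: gauss_diagram_def well_formed_iff set_gauss)
qed

lemma gauss_eq_appendD:
  assumes "gauss w = u @ v"
  obtains u' v' where "w = u' @ v'" "gauss u' = u" "gauss v' = v"
proof -
  have "\<exists>u' v'. w = u' @ v' \<and> gauss u' = u \<and> gauss v' = v"
    using assms
  proof (induction w arbitrary: u)
    case (Cons x w)
    show ?case
    proof (cases "is_virtual x")
      case True
      then obtain u' v' where "w = u' @ v'" "gauss u' = u" "gauss v' = v"
        using Cons.IH[of u] Cons.prems by auto
      then show ?thesis using True by (intro exI[of _ "x # u'"] exI[of _ v']) simp
    next
      case False
      show ?thesis
      proof (cases u)
        case Nil
        then show ?thesis using Cons.prems by (intro exI[of _ "[]"] exI[of _ "x # w"]) simp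
      next
        case (Cons y u1)
        then obtain u' v' where "w = u' @ v'" "gauss u' = u1" "gauss v' = v" "x = y"
          using Cons.IH[of u1] Cons.prems False by auto
        then show ?thesis using False Cons by (intro exI[of _ "x # u'"] exI[of _ v']) simp
      qed
    qed
  qed simp
  then show thesis using that by blast
qed

lemma gauss_eq_ConsD:
  assumes "gauss w = x # v"
  obtains u' v' where "w = u' @ x # v'" "gauss u' = []" "gauss v' = v"
  using assms by (auto simp: gauss_def filter_eq_Cons_iff filter_empty_conv)

lemma diagram_equiv_of_gauss_eq:
  "w \<in> diagrams \<Longrightarrow> w' \<in> diagrams \<Longrightarrow> gauss w = gauss w' \<Longrightarrow> (w, w') \<in> diagram_equiv"
  by (simp add: diagram_equiv_def)

lemma trans_diagram_equiv: "trans diagram_equiv"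
  by (rule transI) (auto simp: diagram_equiv_def intro: equivclp_trans)

lemma fresh_virtual:
  assumes "finite N"
  obtains n where "n \<notin> N" "\<And>l. Virtual n l \<notin> set (w :: word)"
proof -
  have "finite (N \<union> (\<lambda>x. case x of Virtual n l \<Rightarrow> n | _ \<Rightarrow> 0) ` set w)"
    using assms by simp
  then obtain n where n: "n \<notin> N \<union> (\<lambda>x. case x of Virtual n l \<Rightarrow> n | _ \<Rightarrow> 0) ` set w"
    using ex_new_if_finite[OF infinite_UNIV_nat] by metis
  have "Virtual n l \<notin> set w" for l
    using n image_eqI[of n "\<lambda>x. case x of Virtual n l \<Rightarrow> n | _ \<Rightarrow> 0" "Virtual n l" "set w"] by auto
  with n show thesis using that by blast
qed

section \<open>Renaming crossings\<close>

definition exchange :: "nat letter \<Rightarrow> nat letter \<Rightarrow> nat letter \<Rightarrow> nat letter" where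
  "exchange x y z = (if z = x then y else if z = y then x
     else if z = opp x then opp y else if z = opp y then opp x else z)"

text \<open>A renaming that respects \<open>opp\<close> and \<open>leftward\<close> keeps the
  rotation at every vertex, hence conjugates the face permutation. It may well turn a classical
  crossing into a virtual one, a difference that planarity does not see; this is how
  \<open>exchange\<close> is used.\<close>

lemma map_letter_planar:
  assumes w: "four_valent w" "planar w"
    and f: "inj f" "f Bar = Bar" "\<And>x. x \<noteq> Bar \<Longrightarrow> f (opp x) = opp (f x) \<and> leftward (f x) = leftward x"
  shows "four_valent (map f w) \<and> planar (map f w)"
proof -
  note d = four_valentD(1)[OF w(1)]
  have Bar: "f x = Bar \<longleftrightarrow> x = Bar" for x using f(1,2) by (metis injD)
  have ps: "passages (map f w) = map f (passages w)"
    by (induction w) (auto simp: Bar)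
  have neqB: "x \<noteq> Bar" if "x \<in> set (passages w)" for x using that by auto
  have d': "distinct (passages (map f w))"
    using d f(1) by (simp add: ps distinct_map inj_on_subset[OF f(1)])
  have w': "four_valent (map f w)"
    unfolding four_valent_def using d' four_valentD(2)[OF w(1)] f(3) neqB
    by (auto simp: ps) (metis image_eqI)
  have nxt: "next_passage (map f w) (f p) = f (next_passage w p)"
    "prev_passage (map f w) (f p) = f (prev_passage w p)" if p: "p \<in> set (passages w)" for p
  proof -
    obtain us vs where s: "passages w = us @ p # vs" using p by (auto simp: in_set_conv_decomp)
    then have s': "passages (map f w) = map f us @ f p # map f vs" by (simp add: ps)
    show "next_passage (map f w) (f p) = f (next_passage w p)"
      unfolding next_passage_split[OF s d] next_passage_split[OF s' d']
      by (cases vs; cases us) auto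
    show "prev_passage (map f w) (f p) = f (prev_passage w p)"
      unfolding prev_passage_split[OF s d] prev_passage_split[OF s' d']
      using last_map[of "p # vs @ us" f] by simp
  qed
  define k where "k = (\<lambda>(p, b :: bool). (f p, b))"
  have E: "edge (map f w) (k h) = k (edge w h)" if "h \<in> darts w" for h
    using that nxt by (cases h; cases "snd h") (auto simp: k_def)
  have T: "turn (k h) = k (turn h)" if "h \<in> darts w" for h
    using that f(3) neqB by (cases h) (auto simp: k_def)
  have "card (orbit (\<lambda>h. turn (edge (map f w) h)) ` k ` darts w) = card (orbit (\<lambda>h. turn (edge w h)) ` darts w)"
  proof (rule card_orbits_conj)
    show "inj_on k (darts w)"
      using f(1) by (auto simp: k_def inj_on_def dest: injD)
    show "(\<lambda>h. turn (edge w h)) \<in> darts w \<rightarrow> darts w"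
      using edge_edge(1)[OF d] turn_in_darts[OF w(1)] by auto
    show "turn (edge (map f w) (k x)) = k (turn (edge w x))" if "x \<in> darts w" for x
      using E[OF that] T[OF edge_edge(1)[OF d that]] by simp
  qed
  moreover have "k ` darts w = darts (map f w)"
  proof -
    have "h \<in> k ` (A \<times> UNIV) \<longleftrightarrow> h \<in> f ` A \<times> UNIV" for h A
      by (cases h) (auto simp: k_def image_iff)
    then show ?thesis unfolding darts_def ps set_map by blast
  qed
  ultimately have "card (faces (map f w)) = card (faces w)" by (simp add: faces_def)
  then show ?thesis
    using w w' unfolding planar_iff_faces[OF w(1)] planar_iff_faces[OF w'] ps by simp
qed

lemma exchange_props:
  assumes "x \<noteq> Bar" "y \<noteq> Bar" "x \<noteq> y" "x \<noteq> opp y" "leftward x = leftward y"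
  shows "inj (exchange x y)" "exchange x y Bar = Bar"
    "z \<noteq> Bar \<Longrightarrow> exchange x y (opp z) = opp (exchange x y z) \<and> leftward (exchange x y z) = leftward z"
proof -
  have neq: "opp x \<noteq> x" "opp y \<noteq> y" "opp x \<noteq> y" "opp y \<noteq> x"
    using assms opp_neq by auto
  have simps: "exchange x y x = y" "exchange x y y = x" "exchange x y (opp x) = opp y"
    "exchange x y (opp y) = opp x"
    using neq assms(3,4) by (simp_all add: exchange_def)
  have other: "exchange x y z = z" if "z \<noteq> x" "z \<noteq> y" "z \<noteq> opp x" "z \<noteq> opp y" for z
    using that by (simp add: exchange_def)
  have "exchange x y (exchange x y z) = z" for z
  proof (cases "z \<in> {x, y, opp x, opp y}")
    case True
    then show ?thesis by (elim insertE emptyE) (simp_all add: simps)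
  qed (simp add: other)
  then show "inj (exchange x y)" by (metis injI)
  show "exchange x y Bar = Bar" proof (rule other)
    show "Bar \<noteq> x" "Bar \<noteq> y" using assms(1,2) by simp_all
    show "Bar \<noteq> opp x" "Bar \<noteq> opp y" using assms(1,2) by (metis opp_eq_Bar_iff)+
  qed
  assume z: "z \<noteq> Bar"
  show "exchange x y (opp z) = opp (exchange x y z) \<and> leftward (exchange x y z) = leftward z"
  proof (cases "z \<in> {x, y, opp x, opp y}")
    case True
    then show ?thesis
      using simps assms(5) leftward_opp[OF assms(1)] leftward_opp[OF assms(2)]
      by (elim insertE emptyE) simp_all
  next
    case False
    then have "opp z \<noteq> x" "opp z \<noteq> y" by auto
    then show ?thesis using False other[of z] other[of "opp z"] by simp
  qed
qed

text \<open>Moves a letterwise substitution past an insertion. A word obtained by several insertions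
  and a renaming thus becomes one substitution in the original word, and its Gauss diagram can be
  computed letter by letter.\<close>

lemma concat_map_insert_at:
  "concat (map G (insert_at (p, b) x w))
    = concat (map (G(p := if b then G p @ G x else G x @ G p)) w)"
  by (induction w) (auto simp: insert_at_def)

lemma concat_map_virtual_R2:
  assumes "p \<noteq> q" "p \<noteq> Virtual n (a \<noteq> b)" "p \<noteq> Virtual m (a = b)" 
    "q \<noteq> Virtual n (a = b)" "q \<noteq> Virtual m (a \<noteq> b)" "q \<noteq> Virtual m (a = b)" "p \<noteq> Virtual m (a \<noteq> b)"
  shows "concat (map G (virtual_R2 n m p a q b w)) = concat (map
    (G(q := if b then G q @ G (Virtual n (a \<noteq> b)) @ G (Virtual m (a = b))
            else G (Virtual m (a = b)) @ G (Virtual n (a \<noteq> b)) @ G q,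
       p := if a then G p @ G (Virtual n (a = b)) @ G (Virtual m (a \<noteq> b))
            else G (Virtual m (a \<noteq> b)) @ G (Virtual n (a = b)) @ G p)) w)"
  unfolding virtual_R2_def concat_map_insert_at
  using assms by (cases a; cases b) (simp_all add: fun_upd_twist)

lemma edge_adjacent:
  assumes "distinct (passages w)" "passages w = us @ p # q # vs"
  shows "edge w (p, True) = (q, False)" "edge w (q, False) = (p, True)"
  using next_passage_split[of w us p "q # vs"] prev_passage_split[of w "us @ [p]" q vs] assms by auto

section \<open>Removing virtual crossings between two passages\<close>

text \<open>
  A strand crossing just behind the first passage is led along the virtual crossing ahead and made
  to cross behind it; the old crossing becomes virtual.
\<close>

lemma slide_past_virtual:
  assumes w: "w \<in> diagrams" "w = U @ [C, X] @ vs @ Bs @ [D] @ V"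
    and C: "\<not> is_virtual C" "C \<noteq> Bar" and D: "\<not> is_virtual D" "D \<noteq> Bar" "D \<noteq> opp C"
    and vs: "\<forall>x \<in> set (X # vs). is_virtual x" and Bs: "set Bs \<subseteq> {Bar}"
  obtains U' vs' V' where "U' @ [C] @ vs' @ Bs @ [D] @ V' \<in> diagrams"
    "gauss (U' @ [C] @ vs' @ Bs @ [D] @ V') = gauss w" "\<forall>x \<in> set vs'. is_virtual x"
    "length vs' + card {x \<in> set vs'. opp x \<in> set vs'} 
      < length (X # vs) + card {x \<in> set (X # vs). opp x \<in> set (X # vs)}"
proof -
  have w4: "four_valent w" "planar w" and signs: "consistent_signs (gauss w)"
    using w(1) by (simp_all add: diagrams_iff)
  note d = four_valentD(1)[OF w4(1)]
  have X: "is_virtual X" "X \<noteq> Bar" using vs by auto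
  \<comment> \<open>With these values \<open>(opp C, a)\<close> and \<open>(opp X, b)\<close> are
    the half-edges on the left of the strand that runs from \<open>C\<close> to
    \<open>X\<close>.\<close>
  define a b where "a = leftward C" and "b = leftward X"
  have ps: "passages w = passages U @ C # X # passages (vs @ Bs @ [D] @ V)"
    using C(2) X(2) w(2) by simp
  have in_w: "C \<in> set (passages w)" "X \<in> set (passages w)"
    "opp C \<in> set (passages w)" "opp X \<in> set (passages w)"
    using four_valentD(2)[OF w4(1)] by (simp_all add: ps)
  have neq: "opp C \<noteq> opp X" "C \<noteq> opp X" "opp C \<noteq> X" "X \<noteq> C" "opp X \<noteq> X" "opp C \<noteq> C"
    by (metis C X opp_neq is_virtual_opp)+
  obtain n where n: "\<And>l. Virtual n l \<notin> set w" using fresh_virtual[of "{}" w] by auto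
  obtain m where m: "m \<noteq> n" "\<And>l. Virtual m l \<notin> set w" using fresh_virtual[of "{n}" w] by auto
  \<comment> \<open>The transverse strands at \<open>C\<close> and \<open>X\<close> are made to
    cross on the left of the main strand, so that \<open>C\<close>, \<open>X\<close> and
    \<open>n\<close> are the corners of a triangle.\<close>
  define w1 where "w1 = virtual_R2 n m (opp C) a (opp X) b w"
  note e = edge_adjacent[OF d ps]
  have "turn (edge w (turn (opp C, a))) = (opp X, b)"
    using e leftward_opp[OF C(2)] by (simp add: a_def b_def)
  note R = virtual_R2[OF w4(1) in_w(3,4) neq(1) _ this m(1)[symmetric] n m(2), folded w1_def]
  have R: "four_valent w1" "planar w1"
    "set (passages w1) = set (passages w) \<union> {Virtual n True, Virtual n False, Virtual m True, Virtual m False}"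
    "edge w1 (Virtual n (a = b), \<not> a) = (opp C, a)" "edge w1 (opp X, b) = (Virtual n (a \<noteq> b), \<not> b)"
    "edge w1 (Virtual n (a \<noteq> b), \<not> b) = (opp X, b)"
    using R neq w4(2) by simp_all
  obtain n' where n': "n' \<notin> {n, m}" "\<And>l. Virtual n' l \<notin> set w1"
    using fresh_virtual[of "{n, m}" w1] by auto
  obtain m' where m': "m' \<notin> {n, m, n'}" "\<And>l. Virtual m' l \<notin> set w1"
    using fresh_virtual[of "{n, m, n'}" w1] by auto
  have "Virtual k l \<in> set w1" if "Virtual k l \<in> set w" for k l
    using that R(3) by (metis UnI1 virtual_in_passages)
  then have new: "Virtual k l \<notin> set w" if "k \<in> {n, m, n', m'}" for k l
    using that n m(2) n'(2) m'(2) by blast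
  \<comment> \<open>The passage of the transverse strand of \<open>C\<close> at \<open>n\<close>.
    Beyond it this strand lies in a common face with the main strand leaving \<open>X\<close>, and
    the second pair leads it across that strand at \<open>n'\<close> and back at
    \<open>m'\<close>.\<close>
  define Y where "Y = Virtual n (a = b)"
  have YX: "Y \<in> set (passages w1)" "X \<in> set (passages w1)" "Y \<noteq> X" "opp Y \<noteq> X"
    using R(3) in_w new[of n] by (auto simp: Y_def virtual_in_passages)
  have "turn (edge w1 (turn (Y, a))) = (X, True)"
    using R(6) leftward_opp[OF X(2)] by (cases a; cases b) (auto simp: Y_def b_def)
  define w2 where "w2 = virtual_R2 n' m' Y a X True w1"
  have R2: "four_valent w2" "planar w2"
    using virtual_R2(1,2)[OF R(1) YX \<open>turn _ = (X, True)\<close> _ n'(2) m'(2)] m'(1) R(2)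
    by (auto simp: w2_def)
  \<comment> \<open>Followed from \<open>C\<close> to the left, the transverse strand returns across
    the main one at \<open>n'\<close> and crosses it to the left again at \<open>m'\<close>, just as
    it does at \<open>C\<close>. Hence \<open>m'\<close> rather than \<open>n'\<close> can take over
    the name of \<open>C\<close>. On both strands only virtual passages lie between the old place
    and the new one, so the Gauss diagram stays the same.\<close>
  define Z where "Z = Virtual m' a"
  define f where "f = exchange C Z"
  have Z: "Z \<noteq> Bar" "C \<noteq> Z" "C \<noteq> opp Z" "leftward C = leftward Z"
  proof -
    have "is_virtual Z" "is_virtual (opp Z)" by (simp_all add: Z_def)
    with C(1) show "C \<noteq> Z" "C \<noteq> opp Z" by metis+
  qed (simp_all add: Z_def a_def)
  have C_nv: "C \<noteq> Virtual k l" "opp C \<noteq> Virtual k l" for k l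
    using C(1) by (metis is_virtual.simps(1) is_virtual_opp)+
  note ex = exchange_props[OF C(2) Z(1-4), folded f_def]
  define w3 where "w3 = map f w2"
  have w3: "four_valent w3" "planar w3"
    using map_letter_planar[OF R2 ex] by (simp_all add: w3_def)
  have oZ: "opp Z = Virtual m' (\<not> a)" by (simp add: Z_def)
  have f_virt: "f (Virtual k l) = Virtual k l" if "k \<noteq> m'" for k l
    using that C_nv[symmetric] by (simp add: f_def exchange_def Z_def)
  have f_Z: "f (Virtual m' a) = C" "f (Virtual m' (\<not> a)) = opp C" "f C = Z" "f (opp C) = opp Z"
    using neq C_nv C_nv[symmetric] by (simp_all add: f_def exchange_def Z_def)
  have f_old: "f z = z" if "z \<in> set w" "z \<noteq> C" "z \<noteq> opp C" for z
  proof -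
    have "z \<noteq> Virtual m' l" for l using that(1) new[of m' l] by auto
    then show ?thesis using that(2,3) by (simp add: f_def exchange_def Z_def)
  qed
  have fX: "f X = X" "f (opp X) = opp X"
    using f_old[of X] f_old[of "opp X"] in_w neq by (simp_all add: passages_def)
  have nm: "n \<noteq> m" "n \<noteq> n'" "n \<noteq> m'" "m \<noteq> n'" "m \<noteq> m'" "n' \<noteq> m'"
    using n' m' m(1) by auto
  have Xnew: "X \<noteq> Virtual k l" "opp X \<noteq> Virtual k l" "opp C \<noteq> Virtual k l" "C \<noteq> Virtual k l"
    if "k \<in> {n, m, n', m'}" for k l
    using new[OF that] in_w C_nv unfolding passages_def by force+
  \<comment> \<open>\<open>G2 z\<close> will be the word that replaces the letter \<open>z\<close>
    of \<open>w\<close>; \<open>G0\<close> accounts for the renaming, \<open>G1\<close> also for the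
    second pair, \<open>G2\<close> for both pairs. Letters are inserted only next to
    \<open>X\<close>, \<open>opp X\<close> and \<open>opp C\<close>.\<close>
  define G0 where "G0 z = [f z]" for z
  define G1 where "G1 = G0(X := [X, Virtual n' (\<not> a), C],
    Y := if a then [Y, Virtual n' a, opp C] else [opp C, Virtual n' a, Y])"
  define G2 where "G2 = G1(opp X := if b then [opp X, Virtual n (a \<noteq> b), Virtual m (a = b)]
        else [Virtual m (a = b), Virtual n (a \<noteq> b), opp X],
    opp C := if a then [opp Z] @ G1 Y @ [Virtual m (a \<noteq> b)]
        else [Virtual m (a \<noteq> b)] @ G1 Y @ [opp Z])"
  have "w3 = concat (map G0 w2)" by (simp add: w3_def G0_def concat_map_singleton cong: map_cong)
  also have "\<dots> = concat (map G1 w1)"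
    unfolding w2_def
  proof (subst concat_map_virtual_R2)
    show "Y \<noteq> X" "Y \<noteq> Virtual n' (a \<noteq> True)" "Y \<noteq> Virtual m' (a = True)"
      "X \<noteq> Virtual n' (a = True)" "X \<noteq> Virtual m' (a \<noteq> True)" "X \<noteq> Virtual m' (a = True)"
      "Y \<noteq> Virtual m' (a \<noteq> True)"
      using YX Xnew nm by (auto simp: Y_def)
  qed (use f_Z(1,2) in \<open>cases a; simp add: G1_def G0_def f_virt fX nm Y_def\<close>)
  also have "\<dots> = concat (map G2 w)"
    unfolding w1_def
  proof (subst concat_map_virtual_R2)
    show "opp C \<noteq> opp X" "opp C \<noteq> Virtual n (a \<noteq> b)" "opp C \<noteq> Virtual m (a = b)"
      "opp X \<noteq> Virtual n (a = b)" "opp X \<noteq> Virtual m (a \<noteq> b)" "opp X \<noteq> Virtual m (a = b)"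
      "opp C \<noteq> Virtual m (a \<noteq> b)"
      using neq Xnew by auto
    have G1: "G1 (opp C) = [opp Z]" "G1 (opp X) = [opp X]" "G1 (Virtual m l) = [Virtual m l]"
      "G1 (Virtual n (a \<noteq> b)) = [Virtual n (a \<noteq> b)]" for l
      using neq Xnew nm by (auto simp: G1_def G0_def Y_def f_Z f_virt fX)
    show "concat (map (G1(opp X := if b then G1 (opp X) @ G1 (Virtual n (a \<noteq> b)) @ G1 (Virtual m (a = b))
         else G1 (Virtual m (a = b)) @ G1 (Virtual n (a \<noteq> b)) @ G1 (opp X),
       opp C := if a then G1 (opp C) @ G1 (Virtual n (a = b)) @ G1 (Virtual m (a \<noteq> b))
         else G1 (Virtual m (a \<noteq> b)) @ G1 (Virtual n (a = b)) @ G1 (opp C))) w) = concat (map G2 w)"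
      unfolding G2_def G1 Y_def append.simps by (rule refl)
  qed
  finally have w3_eq: "w3 = concat (map G2 w)" .
  have G2_C: "G2 C = [Z]" and G2_X: "G2 X = [X, Virtual n' (\<not> a), C]"
    using neq Xnew YX by (auto simp: G2_def G1_def G0_def f_Z Y_def)
  have G2_oC: "gauss (G2 (opp C)) = [opp C]"
    using C by (auto simp: G2_def G1_def Y_def Z_def)
  have G2_oX: "\<forall>x \<in> set (G2 (opp X)). is_virtual x"
    using X neq by (auto simp: G2_def)
  have G2_old: "G2 z = [z]" if "z \<in> set w" "z \<noteq> C" "z \<noteq> opp C" "z \<noteq> X" "z \<noteq> opp X" for z
    using that f_old[of z] new[of n] by (auto simp: G2_def G1_def G0_def Y_def)
  have notin: "C \<notin> set (U @ vs @ Bs @ [D] @ V)" "X \<notin> set (U @ vs @ Bs @ [D] @ V)"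
  proof -
    have "C \<notin> set (passages (U @ vs @ Bs @ [D] @ V))" "X \<notin> set (passages (U @ vs @ Bs @ [D] @ V))"
      using d unfolding ps by auto
    then show "C \<notin> set (U @ vs @ Bs @ [D] @ V)" "X \<notin> set (U @ vs @ Bs @ [D] @ V)"
      unfolding passages_def set_filter using C(2) X(2) by blast+
  qed
  have sub: "set (U @ vs @ Bs @ [D] @ V) \<subseteq> set w" using w(2) by auto
  have gauss_G2: "gauss (concat (map G2 u)) = gauss u" if "set u \<subseteq> set (U @ vs @ Bs @ [D] @ V)" for u
    using that
  proof (induction u)
    case (Cons z u)
    then have z: "z \<in> set w" "z \<noteq> C" "z \<noteq> X" using notin sub by auto
    have "gauss (G2 z) = gauss [z]"
    proof (cases "z = opp C \<or> z = opp X")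
      case True
      then show ?thesis
        using G2_oC G2_oX C X by (auto simp: gauss_def)
    qed (use G2_old[OF z(1,2) _ z(3)] in auto)
    with Cons show ?case by simp
  qed simp
  have "G2 D = [D]"
  proof (rule G2_old)
    show "D \<in> set w" "D \<noteq> C" "D \<noteq> opp C" "D \<noteq> X" "D \<noteq> opp X" using sub notin D X by auto
  qed
  moreover have "concat (map G2 Bs) = Bs"
  proof -
    have "G2 Bar = [Bar]" if "Bar \<in> set Bs"
    proof (rule G2_old)
      show "Bar \<in> set w" using that w(2) by simp
      show "Bar \<noteq> C" "Bar \<noteq> X" using C X by simp_all
      show "Bar \<noteq> opp C" "Bar \<noteq> opp X" using C X by (metis opp_eq_Bar_iff)+
    qed
    then show ?thesis using Bs by (induction Bs) auto
  qed
  ultimately have form: "w3 = (concat (map G2 U) @ [Z, X, Virtual n' (\<not> a)]) @ [C]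
      @ concat (map G2 vs) @ Bs @ [D] @ concat (map G2 V)"
    unfolding w3_eq w(2) by (simp add: G2_C G2_X)
  have "gauss (concat (map G2 U)) = gauss U" "gauss (concat (map G2 vs)) = gauss vs"
    "gauss (concat (map G2 V)) = gauss V"
    by (rule gauss_G2; auto)+
  then have "gauss w3 = gauss w"
    unfolding form using X by (simp add: w(2) Z_def)
  then have "w3 \<in> diagrams" using w3 signs by (simp add: diagrams_iff)
  moreover have vs_old: "G2 z = [z]" if "z \<in> set vs" "z \<noteq> opp X" for z
    using that sub notin vs C by (intro G2_old) auto
  have virt: "\<forall>x \<in> set (concat (map G2 vs)). is_virtual x"
  proof
    fix x assume "x \<in> set (concat (map G2 vs))"
    then obtain z where "z \<in> set vs" "x \<in> set (G2 z)" by auto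
    then show "is_virtual x"
      using vs vs_old[of z] G2_oX by (cases "z = opp X") auto
  qed
  \<comment> \<open>\<open>X\<close> has left the stretch. If \<open>opp X\<close> lies on it, one
    passage each of \<open>n\<close> and \<open>m\<close> is inserted there, so that the length goes
    up by one in total; but \<open>X\<close> and \<open>opp X\<close> are no longer both on the
    stretch, which lowers the second summand by at least two. The other passages of \<open>n\<close>
    and \<open>m\<close> are next to \<open>opp C\<close>, outside the stretch, so no new
    self-crossing arises.\<close>
  have "length (concat (map G2 vs)) + card {x \<in> set (concat (map G2 vs)). opp x \<in> set (concat (map G2 vs))}
      < length (X # vs) + card {x \<in> set (X # vs). opp x \<in> set (X # vs)}"
  proof (cases "opp X \<in> set vs")
    case False
    have "G2 z = [z]" if "z \<in> set vs" for z using vs_old[OF that] that False by metis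
    then have eq: "concat (map G2 vs) = vs" by (induction vs) auto
    have "card {x \<in> set vs. opp x \<in> set vs} \<le> card {x \<in> set (X # vs). opp x \<in> set (X # vs)}"
      by (rule card_mono) auto
    then show ?thesis unfolding eq by simp
  next
    case True
    then obtain v1 v2 where v: "vs = v1 @ opp X # v2" by (auto simp: in_set_conv_decomp)
    have dv: "distinct vs"
    proof -
      have "passages vs = vs" using vs by (auto simp: passages_def filter_id_conv)
      then show ?thesis using d ps by auto
    qed
    have "G2 z = [z]" if "z \<in> set v1 \<union> set v2" for z
      using vs_old[of z] that v dv by auto
    then have eq: "concat (map G2 v1) = v1" "concat (map G2 v2) = v2"
      by (induction v1, auto) (induction v2, auto)
    define B where "B = {Virtual n (a \<noteq> b), Virtual m (a = b)}"
    have oX: "length (G2 (opp X)) = 3" "set (G2 (opp X)) = insert (opp X) B"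
      using neq by (auto simp: G2_def B_def)
    have "concat (map G2 vs) = v1 @ G2 (opp X) @ v2" by (simp add: v eq)
    then have len: "length (concat (map G2 vs)) = length vs + 2"
      and set_G: "set (concat (map G2 vs)) = set vs \<union> B"
      using oX by (auto simp: v)
    have vw: "set vs \<subseteq> set w" using sub by auto
    have "opp y \<notin> set vs \<union> B" if "y \<in> B" for y
      using that vw new[of n] new[of m] nm(1) by (auto simp: B_def)
    then have "x \<notin> B" "opp x \<notin> B" if "x \<in> set vs \<union> B" "opp x \<in> set vs \<union> B" for x
      using that opp_opp[of x] by metis+
    then have "{x \<in> set vs \<union> B. opp x \<in> set vs \<union> B} \<subseteq> {x \<in> set vs. opp x \<in> set vs}"
      by blast
    moreover have "opp X \<notin> {x \<in> set vs. opp x \<in> set vs}" "X \<notin> {x \<in> set vs. opp x \<in> set vs}"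
      using notin by auto
    moreover have "insert X (insert (opp X) {x \<in> set vs. opp x \<in> set vs})
        \<subseteq> {x \<in> set (X # vs). opp x \<in> set (X # vs)}"
      using True by auto
    moreover have "card (insert X (insert (opp X) {x \<in> set vs. opp x \<in> set vs}))
        = card {x \<in> set vs. opp x \<in> set vs} + 2"
      using notin neq by simp
    ultimately have "card {x \<in> set vs \<union> B. opp x \<in> set vs \<union> B} + 2
        \<le> card {x \<in> set (X # vs). opp x \<in> set (X # vs)}"
      using card_mono[of "{x \<in> set vs. opp x \<in> set vs}" "{x \<in> set vs \<union> B. opp x \<in> set vs \<union> B}"]
        card_mono[of "{x \<in> set (X # vs). opp x \<in> set (X # vs)}"
          "insert X (insert (opp X) {x \<in> set vs. opp x \<in> set vs})"] by simp
    then show ?thesis unfolding set_G len by simp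
  qed
  ultimately show thesis
    using that[of "concat (map G2 U) @ [Z, X, Virtual n' (\<not> a)]" "concat (map G2 vs)" "concat (map G2 V)"]
      virt \<open>gauss w3 = gauss w\<close> unfolding form by blast
qed

text \<open>The number of virtual passages between \<open>C\<close> and \<open>D\<close> need not
  drop in a slide. Adding the number of those whose crossing is met twice within the stretch gives a
  measure that does.\<close>

lemma make_adjacent:
  assumes "U @ [C] @ vs @ Bs @ [D] @ V \<in> diagrams"
    and "\<not> is_virtual C" "C \<noteq> Bar" "\<not> is_virtual D" "D \<noteq> Bar" "D \<noteq> opp C"
    and "\<forall>x \<in> set vs. is_virtual x" "set Bs \<subseteq> {Bar}"
  shows "\<exists>U' V'. U' @ [C] @ Bs @ [D] @ V' \<in> diagrams \<and>
    gauss (U' @ [C] @ Bs @ [D] @ V') = gauss (U @ [C] @ vs @ Bs @ [D] @ V)"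
  using assms(1,7)
proof (induction "length vs + card {x \<in> set vs. opp x \<in> set vs}" arbitrary: U vs V rule: less_induct)
  case less
  show ?case
  proof (cases vs)
    case Nil
    then show ?thesis using less.prems by auto
  next
    case (Cons X vs1)
    have eq: "U @ [C] @ vs @ Bs @ [D] @ V = U @ [C, X] @ vs1 @ Bs @ [D] @ V" by (simp add: Cons)
    have "\<forall>x \<in> set (X # vs1). is_virtual x" using less.prems(2) Cons by simp
    from slide_past_virtual[OF less.prems(1) eq assms(2-6) this assms(8)]
    obtain U' vs' V' where new: "U' @ [C] @ vs' @ Bs @ [D] @ V' \<in> diagrams"
      "gauss (U' @ [C] @ vs' @ Bs @ [D] @ V') = gauss (U @ [C] @ vs @ Bs @ [D] @ V)"
      "\<forall>x \<in> set vs'. is_virtual x"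
      "length vs' + card {x \<in> set vs'. opp x \<in> set vs'} < length vs + card {x \<in> set vs. opp x \<in> set vs}"
      unfolding Cons by blast
    from less.hyps[OF new(4,1,3)] show ?thesis unfolding new(2) .
  qed
qed

section \<open>Region arc shifts realizing the forbidden moves\<close>

lemma arc_shift_eq_map:
  assumes "\<And>x. x \<in> A \<union> next_passage w ` A \<Longrightarrow> opp x \<in> A \<union> next_passage w ` A"
  shows "arc_shift w A = map (\<lambda>x. if x \<in> A then next_passage w x
      else if x \<in> next_passage w ` A then prev_passage w x else x) w"
proof -
  have "(x \<in> A \<union> next_passage w ` A) = (opp x \<in> A \<union> next_passage w ` A)" for x
    using assms[of x] assms[of "opp x"] by auto
  then show ?thesis
    unfolding arc_shift_def Let_def by (intro map_cong refl) auto
qed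

lemma gauss_concat_map:
  assumes "\<And>x. x \<in> set w \<Longrightarrow> gauss (G x) = map f (gauss [x])"
  shows "gauss (concat (map G w)) = map f (gauss w)"
  using assms
proof (induction w)
  case (Cons x w)
  then have "gauss (G x) = map f (gauss [x])" "gauss (concat (map G w)) = map f (gauss w)" by simp_all
  then show ?case by (cases "is_virtual x") simp_all
qed simp

text \<open>The triangle stands on the left of the edge from \<open>C\<close> to \<open>D\<close>;
  its other sides join \<open>opp C\<close> and \<open>opp D\<close> to the virtual crossing
  \<open>n\<close>. Shifting these two sides only moves a classical passage over a virtual one, so
  the transposition of \<open>C\<close> and \<open>D\<close> is all that remains visible. Bars in
  \<open>Bs\<close> keep their places, which treats the cases with and without a bar at
  once.\<close>

lemma exchange_by_region_shift:
  assumes w: "w \<in> diagrams" "w = U @ [C] @ Bs @ [D] @ V"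
    and C: "\<not> is_virtual C" "C \<noteq> Bar" and D: "\<not> is_virtual D" "D \<noteq> Bar" "D \<noteq> opp C"
    and Bs: "set Bs \<subseteq> {Bar}"
  obtains w' where "w' \<in> diagrams" "gauss w' = gauss w"
    "\<exists>R \<in> regions w'. disjoint_arcs w' (boundary_arcs R) \<and>
      gauss (arc_shift w' (boundary_arcs R)) = map (transpose C D) (gauss w)"
proof -
  have w4: "four_valent w" "planar w" and signs: "consistent_signs (gauss w)"
    using w(1) by (simp_all add: diagrams_iff)
  note d = four_valentD(1)[OF w4(1)]
  define a b where "a = leftward C" and "b = leftward D"
  have pBs: "passages Bs = []" using Bs by (auto simp: passages_def filter_empty_conv)
  have ps: "passages w = passages U @ C # D # passages V"
    using C(2) D(2) w(2) pBs by simp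
  have in_w: "C \<in> set (passages w)" "D \<in> set (passages w)"
    "opp C \<in> set (passages w)" "opp D \<in> set (passages w)"
    using four_valentD(2)[OF w4(1)] by (simp_all add: ps)
  then have in_w': "C \<in> set w" "D \<in> set w" "opp C \<in> set w" "opp D \<in> set w"
    by (auto simp: passages_def)
  have CD: "C \<noteq> D" using d ps by auto
  have neq: "opp C \<noteq> opp D" "C \<noteq> opp D" "opp C \<noteq> D" "opp D \<noteq> D" "opp C \<noteq> C"
    using CD D opp_neq[OF C(2)] opp_neq[OF D(2)] by (simp, metis opp_opp, metis, metis, metis)
  obtain n where n: "\<And>l. Virtual n l \<notin> set w" using fresh_virtual[of "{}" w] by auto
  obtain m where m: "m \<noteq> n" "\<And>l. Virtual m l \<notin> set w" using fresh_virtual[of "{n}" w] by auto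
  define w1 where "w1 = virtual_R2 n m (opp C) a (opp D) b w"
  note e = edge_adjacent[OF d ps]
  have face: "turn (edge w (turn (opp C, a))) = (opp D, b)"
    using e leftward_opp[OF C(2)] by (simp add: a_def b_def)
  have hyp: "opp (opp C) \<noteq> opp D" using neq by simp
  note R2 = virtual_R2[OF w4(1) in_w(3,4) neq(1) hyp face m(1)[symmetric] n m(2), folded w1_def]
  define YC YD where Y: "YC = Virtual n (a = b)" "YD = Virtual n (a \<noteq> b)"
  have oY: "opp YC = YD" "opp YD = YC" by (auto simp: Y)
  have E: "edge w1 (opp C, a) = (YC, \<not> a)" "edge w1 (YC, \<not> a) = (opp C, a)"
    "edge w1 (opp D, b) = (YD, \<not> b)" "edge w1 (YD, \<not> b) = (opp D, b)"
    using R2(4-7) by (simp_all add: Y)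
  have "edge w1 (C, True) = edge w (C, True)"
  proof (rule R2(8))
    have "edge w (opp C, a) \<noteq> (C, True)" "edge w (opp D, b) \<noteq> (C, True)"
      using edge_edge(2)[OF d, of "(opp C, a)"] edge_edge(2)[OF d, of "(opp D, b)"] in_w e neq by auto
    then show "(C, True) \<in> darts w - {(opp C, a), (opp D, b), edge w (opp C, a), edge w (opp D, b)}"
      using in_w neq by auto
  qed
  then have E_C: "edge w1 (C, True) = (D, False)" using e(1) by simp
  have Y_new: "YC \<notin> set w" "YD \<notin> set w" using n by (simp_all add: Y)
  have Y_neq: "YC \<noteq> YD" "YC \<noteq> C" "YC \<noteq> D" "YC \<noteq> opp C" "YC \<noteq> opp D"
    "YD \<noteq> C" "YD \<noteq> D" "YD \<noteq> opp C" "YD \<noteq> opp D"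
    using Y_new in_w' oY opp_neq[of YC] by (auto simp: Y)
  note d1 = four_valentD(1)[OF R2(1)]
  \<comment> \<open>Stated for an arbitrary letter map \<open>t\<close>: the identity shows that the
    insertion is invisible on the Gauss diagram, and the arc shift yields the transposition.\<close>
  have gauss_w1: "gauss (map t w1) = map f (gauss w)"
    if t: "\<And>l. is_virtual (t (Virtual m l))"
      "gauss [t (opp D), t YD] = [f (opp D)]" "gauss [t YD, t (opp D)] = [f (opp D)]"
      "gauss [t (opp C), t YC] = [f (opp C)]" "gauss [t YC, t (opp C)] = [f (opp C)]"
      "\<And>x. x \<in> set w \<Longrightarrow> x \<noteq> opp C \<Longrightarrow> x \<noteq> opp D \<Longrightarrow> gauss [t x] = map f (gauss [x])" for t f
  proof -
    have "map t w1 = concat (map (\<lambda>x. [t x]) w1)" by (simp add: concat_map_singleton)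
    also have "gauss \<dots> = map f (gauss w)"
      unfolding w1_def
    proof (subst concat_map_virtual_R2)
      show "opp C \<noteq> opp D" "opp C \<noteq> Virtual n (a \<noteq> b)" "opp C \<noteq> Virtual m (a = b)"
        "opp D \<noteq> Virtual n (a = b)" "opp D \<noteq> Virtual m (a \<noteq> b)" "opp D \<noteq> Virtual m (a = b)"
        "opp C \<noteq> Virtual m (a \<noteq> b)"
        using neq n m(2) in_w' by metis+
      have nv: "\<not> is_virtual (opp C)" "\<not> is_virtual (opp D)" using C D by simp_all
      show "gauss (concat (map ((\<lambda>x. [t x])(opp D := if b then [t (opp D)] @ [t (Virtual n (a \<noteq> b))] @ [t (Virtual m (a = b))]
            else [t (Virtual m (a = b))] @ [t (Virtual n (a \<noteq> b))] @ [t (opp D)],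
          opp C := if a then [t (opp C)] @ [t (Virtual n (a = b))] @ [t (Virtual m (a \<noteq> b))]
            else [t (Virtual m (a \<noteq> b))] @ [t (Virtual n (a = b))] @ [t (opp C)])) w)) = map f (gauss w)"
      proof (rule gauss_concat_map, goal_cases)
        case (1 x)
        consider "x = opp C" | "x = opp D" | "x \<noteq> opp C" "x \<noteq> opp D" by blast
        then show ?case
        proof cases
          case 1
          then show ?thesis unfolding Y(1)[symmetric] using t(1,4,5) nv by (auto split: if_splits)
        next
          case 2
          then show ?thesis unfolding Y(2)[symmetric] using t(1,2,3) nv neq by (auto split: if_splits)
        next
          case 3
          then show ?thesis using t(6)[OF 1] by simp
        qed
      qed
    qed
    finally show ?thesis .
  qed
  \<comment> \<open>\<open>P2\<close> and \<open>P3\<close> are the passages at which the other two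
    sides of the triangle start in the orientation of the knot, \<open>Q2\<close> and
    \<open>Q3\<close> those at which they end. Which end comes first depends on whether the
    transverse strands leave \<open>D\<close> and \<open>C\<close> forwards or backwards on the
    left.\<close>
  define P2 where "P2 = (if b then opp D else YD)"
  define Q2 where "Q2 = (if b then YD else opp D)"
  define P3 where "P3 = (if a then opp C else YC)"
  define Q3 where "Q3 = (if a then YC else opp C)"
  have in1: "C \<in> set (passages w1)" "P2 \<in> set (passages w1)" "P3 \<in> set (passages w1)"
    using in_w R2(3) by (auto simp: P2_def P3_def Y)
  have nxt: "next_passage w1 C = D" "next_passage w1 P2 = Q2" "next_passage w1 P3 = Q3"
    using E E_C by (auto simp: P2_def P3_def Q2_def Q3_def)
  then have prv: "prev_passage w1 D = C" "prev_passage w1 Q2 = P2" "prev_passage w1 Q3 = P3"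
    using prev_next_passage(1)[OF in1(1) d1] prev_next_passage(1)[OF in1(2) d1]
      prev_next_passage(1)[OF in1(3) d1] by simp_all
  have lY: "leftward YD \<longleftrightarrow> a \<noteq> b" "leftward YC \<longleftrightarrow> a = b" by (simp_all add: Y)
  have lC: "leftward (opp C) \<longleftrightarrow> \<not> a" "leftward (opp D) \<longleftrightarrow> \<not> b"
    using leftward_opp[OF C(2)] leftward_opp[OF D(2)] by (simp_all add: a_def b_def)
  have s1: "face_step w1 (C, True) = (P2, b)"
    using nxt(1) prv(2) by (auto simp: P2_def Q2_def b_def)
  have s2: "face_step w1 (P2, b) = (P3, \<not> a)"
    using nxt(2) prv(3) lY oY by (cases b) (auto simp: P2_def Q2_def P3_def Q3_def)
  have s3: "face_step w1 (P3, \<not> a) = (C, True)"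
    using nxt(3) lC by (cases a) (auto simp: P3_def Q3_def)
  define R where "R = orbit (face_step w1) (C, True)"
  have "R = {(C, True), (P2, b), (P3, \<not> a)}"
    unfolding R_def using orbit_of_period_three[of "face_step w1" "(C, True)"] s1 s2 s3 by simp
  then have arcs: "boundary_arcs R = {C, P2, P3}" by (auto simp: boundary_arcs_def)
  have "R \<in> regions w1" using in1(1) by (simp add: R_def regions_def)
  moreover have "disjoint_arcs w1 {C, P2, P3}"
    using nxt neq CD Y_neq Y_neq[symmetric] by (auto simp: disjoint_arcs_def P2_def P3_def Q2_def Q3_def)
  moreover have "gauss (arc_shift w1 {C, P2, P3}) = map (transpose C D) (gauss w)"
  proof -
    define t where "t x = (if x = C then D else if x = D then C else if x = opp D then YD
      else if x = YD then opp D else if x = opp C then YC else if x = YC then opp C else x)" for x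
    have "arc_shift w1 {C, P2, P3} = map (\<lambda>x. if x \<in> {C, P2, P3} then next_passage w1 x
        else if x \<in> next_passage w1 ` {C, P2, P3} then prev_passage w1 x else x) w1"
    proof (rule arc_shift_eq_map)
      have S: "{C, P2, P3} \<union> next_passage w1 ` {C, P2, P3} = {C, D, opp C, opp D, YC, YD}"
        by (simp only: nxt image_insert image_empty) (auto simp: P2_def P3_def Q2_def Q3_def)
      show "opp x \<in> {C, P2, P3} \<union> next_passage w1 ` {C, P2, P3}"
        if "x \<in> {C, P2, P3} \<union> next_passage w1 ` {C, P2, P3}" for x
        using that unfolding S by (auto simp: oY)
    qed
    also have "\<dots> = map t w1"
    proof (intro map_cong refl)
      fix x
      show "(if x \<in> {C, P2, P3} then next_passage w1 x
          else if x \<in> next_passage w1 ` {C, P2, P3} then prev_passage w1 x else x) = t x"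
      proof (cases "x \<in> {C, D, P2, Q2, P3, Q3}")
        case True
        have "t C = D" "t D = C" "t P2 = Q2" "t Q2 = P2" "t P3 = Q3" "t Q3 = P3"
          using neq CD Y_neq unfolding t_def P2_def Q2_def P3_def Q3_def by auto
        moreover have "distinct [C, D, P2, Q2, P3, Q3]"
          using neq CD Y_neq unfolding P2_def Q2_def P3_def Q3_def by auto
        ultimately show ?thesis
          using True nxt prv by (elim insertE emptyE) auto
      next
        case False
        then have "x \<noteq> opp D" "x \<noteq> YD" "x \<noteq> opp C" "x \<noteq> YC"
          unfolding P2_def Q2_def P3_def Q3_def by (cases b; cases a; auto)+
        then show ?thesis using False nxt by (auto simp: t_def)
      qed
    qed
    also have "gauss \<dots> = map (transpose C D) (gauss w)"
    proof (rule gauss_w1)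
      have t_Y: "t (opp D) = YD" "t YD = opp D" "t (opp C) = YC" "t YC = opp C"
        using neq CD Y_neq unfolding t_def by auto
      have tr: "transpose C D (opp C) = opp C" "transpose C D (opp D) = opp D"
        using neq by (simp_all add: transpose_def)
      have nv: "\<not> is_virtual (opp C)" "\<not> is_virtual (opp D)" "is_virtual YC" "is_virtual YD"
        using C D by (simp_all add: Y)
      show "gauss [t (opp D), t YD] = [transpose C D (opp D)]"
        "gauss [t YD, t (opp D)] = [transpose C D (opp D)]"
        "gauss [t (opp C), t YC] = [transpose C D (opp C)]"
        "gauss [t YC, t (opp C)] = [transpose C D (opp C)]"
        unfolding t_Y tr using nv by simp_all
      show "is_virtual (t (Virtual m l))" for l
      proof -
        have "Virtual m l \<notin> {C, D, opp C, opp D}" using m(2)[of l] in_w' by auto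
        moreover have "Virtual m l \<noteq> YC" "Virtual m l \<noteq> YD" using m(1) by (simp_all add: Y)
        ultimately show ?thesis by (simp add: t_def)
      qed
      show "gauss [t x] = map (transpose C D) (gauss [x])"
        if "x \<in> set w" "x \<noteq> opp C" "x \<noteq> opp D" for x
      proof -
        have "x \<noteq> YC" "x \<noteq> YD" using that(1) Y_new by auto
        then have "t x = transpose C D x" using that by (simp add: t_def transpose_def)
        moreover have "is_virtual (transpose C D x) = is_virtual x"
          using C D by (simp add: transpose_def)
        ultimately show ?thesis by simp
      qed
    qed
    finally show ?thesis .
  qed
  moreover have "gauss w1 = gauss w"
    using gauss_w1[of "\<lambda>x. x" "\<lambda>x. x"] C D by (simp add: Y)
  moreover have "w1 \<in> diagrams" using R2(1,2) w4(2) signs \<open>gauss w1 = gauss w\<close> by (simp add: diagrams_iff)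
  ultimately show thesis using that[of w1] unfolding arcs[symmetric] by blast
qed

section \<open>Kinks and the bigon for \<open>T4\<close>\<close>

lemma insert_kink:
  assumes w: "four_valent w" "planar w" "passages w = us @ vs"
    and x: "x \<noteq> Bar" "x \<notin> set (us @ vs)" "opp x \<notin> set (us @ vs)"
    and w': "passages w' = us @ [x, opp x] @ vs"
  shows "four_valent w' \<and> planar w'"
proof (cases us rule: rev_cases)
  case (snoc us' p)
  have p: "p \<noteq> Bar" "p \<in> set (passages w)" using w(3) snoc not_Bar_in_passages[of w] by auto
  have notin: "p \<notin> set us'" "p \<notin> set vs" "p \<noteq> opp x"
    using four_valentD(1)[OF w(1)] w(3) snoc x by auto
  have ox: "opp x \<noteq> Bar" using x by simp
  have "passages (insert_at (p, True) x (insert_at (p, True) (opp x) w))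
      = insert_at (p, True) x (insert_at (p, True) (opp x) (us' @ p # vs))"
    using w(3) snoc by (simp add: passages_insert_at[OF p(1)] x(1) ox)
  also have "\<dots> = passages w'"
    using insert_at_split[OF notin(1,2), of True "opp x"]
      insert_at_split[of p us' "opp x # vs" True x] notin w' snoc by simp
  finally show ?thesis
    using planar_kink[OF w(1,2) p(2), where x = x and b = True] x w(3) planar_cong four_valent_cong by metis
next
  case us: Nil
  show ?thesis
  proof (cases vs)
    case (Cons p vs')
    have p: "p \<noteq> Bar" "p \<in> set (passages w)" using w(3) us Cons not_Bar_in_passages[of w] by auto
    have notin: "p \<notin> set vs'" "p \<noteq> x"
      using four_valentD(1)[OF w(1)] w(3) us Cons x by auto
    have ox: "opp x \<noteq> Bar" using x by simp
    have "passages (insert_at (p, False) (opp x) (insert_at (p, False) x w))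
        = insert_at (p, False) (opp x) (insert_at (p, False) x (p # vs'))"
      using w(3) us Cons by (simp add: passages_insert_at[OF p(1)] x(1) ox)
    also have "\<dots> = passages w'"
      using insert_at_split[of p "[]" vs' False x]
        insert_at_split[of p "[x]" vs' False "opp x"] notin w' us Cons by simp
    finally show ?thesis
      using planar_kink[OF w(1,2) p(2), where x = "opp x" and b = False] x ox w(3) planar_cong four_valent_cong
      by (metis opp_opp)
  next
    case Nil
    \<comment> \<open>The crossingless circle has no half-edge to carry the kink and is planar by
      convention, so the faces of the resulting figure eight are listed: Euler's formula reads 1 + 3
      = 2 + 2.\<close>
    define y where "y = opp x"
    have y: "y \<noteq> x" "opp y = x" "opp x = y" "leftward y \<longleftrightarrow> \<not> leftward x"
      using opp_neq[OF x(1)] leftward_opp[OF x(1)] by (simp_all add: y_def)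
    have ps: "passages w' = [x, y]" using w' us Nil by (simp add: y_def)
    have w'4: "four_valent w'" using ps y by (simp add: four_valent_def)
    have E: "edge w' (x, True) = (y, False)" "edge w' (y, True) = (x, False)"
      "edge w' (x, False) = (y, True)" "edge w' (y, False) = (x, True)"
      using y by (auto simp: next_passage_def prev_passage_def ps)
    define f where "f = (\<lambda>h. turn (edge w' h))"
    have f: "f (x, c) = (x, leftward x \<noteq> c)" "f (y, c) = (y, leftward x = c)" for c
      using y E by (cases c; simp add: f_def)+
    have darts: "darts w' = {(x, True), (x, False), (y, True), (y, False)}"
      using ps by (auto simp: darts_def)
    have orbits: "orbit f (x, c) = {(x, c), f (x, c)}" "orbit f (y, c) = {(y, c), f (y, c)}" for c
      by (rule orbit_of_involutive_map, cases "leftward x"; simp add: f)+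
    have "card (faces w') = 3"
    proof (cases "leftward x")
      case True
      have "faces w' = {{(x, True), (x, False)}, {(y, True)}, {(y, False)}}"
        unfolding faces_def darts f_def[symmetric] using True by (auto simp: orbits f)
      then show ?thesis using y by (simp add: doubleton_eq_iff)
    next
      case False
      have "faces w' = {{(y, True), (y, False)}, {(x, True)}, {(x, False)}}"
        unfolding faces_def darts f_def[symmetric] using False by (auto simp: orbits f)
      then show ?thesis using y by (simp add: doubleton_eq_iff)
    qed
    then show ?thesis using w'4 ps by (simp add: planar_iff_faces)
  qed
qed

text \<open>With \<open>leftward X = leftward (opp C)\<close> the edges from \<open>C\<close> to
  \<open>X\<close> and from \<open>opp X\<close> to \<open>opp C\<close> bound a region by
  themselves. With the other value of \<open>leftward X\<close> the edge of the kink would be on the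
  boundary of that region too, and its arc would overlap the other two.\<close>

lemma bigon_shift:
  assumes w: "w \<in> diagrams" "w = U @ [C, Bar, X, opp X, opp C] @ V"
    and C: "C \<noteq> Bar" and X: "X \<noteq> Bar" "leftward X = leftward (opp C)"
  shows "\<exists>R \<in> regions w. disjoint_arcs w (boundary_arcs R) \<and>
    arc_shift w (boundary_arcs R) = U @ [X, Bar, C, opp C, opp X] @ V"
proof -
  have w4: "four_valent w" using w(1) by (simp add: diagrams_iff)
  note d = four_valentD(1)[OF w4]
  have ps: "passages w = passages U @ C # X # opp X # opp C # passages V"
    using C X by (simp add: w(2))
  then have neq: "distinct [C, X, opp X, opp C]"
    and notin: "set [C, X, opp X, opp C] \<inter> set (passages U @ passages V) = {}"
    using d by auto
  note E = edge_adjacent[OF d, of "passages U" C X]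
    edge_adjacent[OF d, of "passages U @ [C]" X "opp X"]
    edge_adjacent[OF d, of "passages U @ [C, X]" "opp X" "opp C"]
  have nxt: "next_passage w C = X" "next_passage w X = opp X" "next_passage w (opp X) = opp C"
    "prev_passage w X = C" "prev_passage w (opp C) = opp X"
    using E ps by auto
  define l where "l = leftward X"
  have lw: "leftward C \<longleftrightarrow> \<not> l" "leftward (opp C) \<longleftrightarrow> l" "leftward (opp X) \<longleftrightarrow> \<not> l"
    using X leftward_opp[OF C] leftward_opp[OF X(1)] by (simp_all add: l_def)
  have s: "face_step w (C, l) = (opp X, l)" "face_step w (opp X, l) = (C, l)"
    using nxt lw by (cases l; simp add: l_def)+
  define R where "R = orbit (face_step w) (C, l)"
  have "R = {(C, l), (opp X, l)}"
    unfolding R_def using orbit_of_involutive_map[of "face_step w" "(C, l)"] s by simp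
  then have arcs: "boundary_arcs R = {C, opp X}" by (auto simp: boundary_arcs_def)
  have "R \<in> regions w" using ps by (simp add: R_def regions_def)
  moreover have "disjoint_arcs w {C, opp X}"
    using nxt neq by (auto simp: disjoint_arcs_def)
  moreover have "arc_shift w {C, opp X} = U @ [X, Bar, C, opp C, opp X] @ V"
  proof -
    define t where "t x = (if x \<in> {C, opp X} then next_passage w x
      else if x \<in> next_passage w ` {C, opp X} then prev_passage w x else x)" for x
    have "arc_shift w {C, opp X} = map t w"
      unfolding t_def by (rule arc_shift_eq_map) (auto simp: nxt)
    moreover have "t x = x" if "x \<in> set (U @ V)" for x
    proof -
      have "x \<notin> set [C, X, opp X, opp C]"
        using that notin C X by (auto simp: passages_def)
      then show ?thesis by (auto simp: t_def nxt)
    qed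
    then have "map t U = U" "map t V = V" by (simp_all add: map_idI)
    moreover have "t Bar = Bar" "t C = X" "t X = C" "t (opp X) = opp C" "t (opp C) = opp X"
    proof -
      have "Bar \<noteq> opp X" "Bar \<noteq> opp C" using C X by (metis opp_eq_Bar_iff)+
      then show "t Bar = Bar" using C X(1) nxt by (auto simp: t_def)
    qed (use neq nxt in \<open>auto simp: t_def\<close>)
    ultimately show ?thesis by (simp add: w(2))
  qed
  ultimately show ?thesis unfolding arcs[symmetric] by blast
qed

lemma region_arc_shift_of_exchange:
  assumes D: "D \<in> diagrams" "D' \<in> diagrams"
    and g: "gauss D = u @ [Classical c ov s] @ Bs @ [Classical d ov t] @ v"
      "gauss D' = u @ [Classical d ov t] @ Bs @ [Classical c ov s] @ v"
    and Bs: "set Bs \<subseteq> {Bar}"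
  shows "(D, D') \<in> diagram_equiv O region_arc_shift_move"
proof -
  let ?C = "Classical c ov s" and ?D = "Classical d ov t"
  have D4: "four_valent D" "planar D" and signs: "consistent_signs (gauss D)"
    using D(1) by (simp_all add: diagrams_iff)
  obtain U Y where 1: "D = U @ Y" "gauss U = u" "gauss Y = ?C # Bs @ [?D] @ v"
    using g(1) by (auto elim: gauss_eq_appendD)
  obtain N Z where 2: "Y = N @ ?C # Z" "gauss N = []" "gauss Z = Bs @ [?D] @ v"
    using 1(3) by (auto elim: gauss_eq_ConsD)
  obtain M W where 3: "Z = M @ W" "gauss M = Bs" "gauss W = ?D # v"
    using 2(3) by (auto elim: gauss_eq_appendD)
  obtain M' V where 4: "W = M' @ ?D # V" "gauss M' = []" "gauss V = v"
    using 3(3) by (auto elim: gauss_eq_ConsD)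
  \<comment> \<open>In the given diagram bars and virtual passages may alternate between the two
    endpoints. Bars do not matter for planarity, so all virtual passages are collected in front of
    the bars before they are cleared.\<close>
  define vs where "vs = filter is_virtual (M @ M')"
  define D0 where "D0 = (U @ N) @ [?C] @ vs @ Bs @ [?D] @ V"
  have MM: "set (gauss (M @ M')) \<subseteq> {Bar}" using 3(2) 4(2) Bs by simp
  have "passages (vs @ Bs) = passages (M @ M')"
  proof -
    have "passages Bs = []" using Bs by (auto simp: passages_def filter_empty_conv)
    moreover have "passages vs = passages (M @ M')"
      unfolding passages_def vs_def filter_filter using MM
      by (intro filter_cong refl) (auto simp: set_gauss)
    ultimately show ?thesis by simp
  qed
  then have "passages D0 = passages D" by (simp add: D0_def 1(1) 2(1) 3(1) 4(1))
  moreover have "gauss vs = []" by (simp add: vs_def gauss_def)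
  moreover have "gauss Bs = Bs" using Bs by (auto simp: gauss_def filter_id_conv)
  ultimately have g0: "gauss D0 = gauss D" and D0: "D0 \<in> diagrams"
    using D4 signs planar_cong[of D0 D] four_valent_cong[of D0 D] g(1) 1(2) 2(2) 4(3)
    by (simp_all add: D0_def diagrams_iff)
  have "\<forall>x \<in> set vs. is_virtual x" by (auto simp: vs_def)
  \<comment> \<open>Both letters carry the same \<open>ov\<close>, so the second one is not
    \<open>opp\<close> of the first, as the slides require.\<close>
  from make_adjacent[OF D0[unfolded D0_def] _ _ _ _ _ this Bs]
  obtain U1 V1 where w: "U1 @ [?C] @ Bs @ [?D] @ V1 \<in> diagrams"
    "gauss (U1 @ [?C] @ Bs @ [?D] @ V1) = gauss D"
    unfolding g0[unfolded D0_def] by (simp del: append_Cons append.simps) blast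
  obtain w' where w': "w' \<in> diagrams" "gauss w' = gauss D"
    "\<exists>R \<in> regions w'. disjoint_arcs w' (boundary_arcs R) \<and>
      gauss (arc_shift w' (boundary_arcs R)) = map (transpose ?C ?D) (gauss D)"
    using exchange_by_region_shift[OF w(1) refl _ _ _ _ _ Bs] unfolding w(2) by (simp; blast)
  have "map (transpose ?C ?D) (gauss D) = gauss D'"
  proof -
    have "distinct (passages (gauss D))"
      using gauss_diagram_gauss[OF D4(1) signs] by (simp add: gauss_diagram_def well_formed_def)
    then have "?C \<notin> set (passages u @ passages v)" "?D \<notin> set (passages u @ passages v)"
      unfolding g(1) by auto
    then have "x \<noteq> ?C" "x \<noteq> ?D" if "x \<in> set u \<union> set v \<union> set Bs" for x
      using that Bs by (auto simp: passages_def)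
    then have "map (transpose ?C ?D) u = u" "map (transpose ?C ?D) v = v"
      "map (transpose ?C ?D) Bs = Bs"
      by (auto simp: transpose_def intro!: map_idI)
    then show ?thesis unfolding g by simp
  qed
  then have "(w', D') \<in> region_arc_shift_move"
    using w' D(2) by (auto simp: region_arc_shift_move_def)
  moreover have "(D, w') \<in> diagram_equiv"
    using diagram_equiv_of_gauss_eq D(1) w' by simp
  ultimately show ?thesis by blast
qed

text \<open>Virtual passages inside the loop of the chord would be awkward to clear, so both ends of
  the shift are built from \<open>D'\<close> by nested kinks. With \<open>C\<close> outside and
  \<open>X\<close> inside, the word has the Gauss diagram of \<open>D\<close>; with \<open>X\<close>
  outside and \<open>C\<close> inside, it is the shifted word, whose chord is isolated and one
  \<open>R1\<close> move away from \<open>D'\<close>. Planarity of both comes from the kinks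
  alone.\<close>

lemma region_arc_shift_of_T4:
  assumes D: "D \<in> diagrams" "D' \<in> diagrams"
    and g: "gauss D = u @ [Classical c ov s, Bar, Classical c (\<not> ov) s] @ v"
      "gauss D' = u @ [Bar] @ v"
  shows "(D, D') \<in> diagram_equiv O region_arc_shift_move O diagram_equiv"
proof -
  define C where "C = Classical c ov s"
  have D4: "four_valent D'" "planar D'" "four_valent D"
    and signs: "consistent_signs (gauss D)" "consistent_signs (gauss D')"
    using D by (simp_all add: diagrams_iff)
  obtain U Y where 1: "D' = U @ Y" "gauss U = u" "gauss Y = Bar # v"
    using g(2) by (auto elim: gauss_eq_appendD)
  obtain N V where 2: "Y = N @ Bar # V" "gauss N = []" "gauss V = v"
    using 1(3) by (auto elim: gauss_eq_ConsD)
  define U' where "U' = U @ N"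
  have D': "D' = U' @ [Bar] @ V" "gauss U' = u" by (simp_all add: 1 2 U'_def)
  obtain n where n: "\<And>l. Virtual n l \<notin> set D'" using fresh_virtual[of "{}" D'] by auto
  define X where "X = Virtual n (leftward (opp C))"
  have CX: "C \<noteq> Bar" "X \<noteq> Bar" "leftward X = leftward (opp C)" by (simp_all add: C_def X_def)
  define w1 where "w1 = U' @ [C, Bar, X, opp X, opp C] @ V"
  define w2 where "w2 = U' @ [X, Bar, C, opp C, opp X] @ V"
  have X_new: "X \<notin> set (passages U' @ passages V)" "opp X \<notin> set (passages U' @ passages V)"
    using n by (auto simp: X_def D' passages_def)
  have C_new: "C \<notin> set (passages U' @ passages V)" "opp C \<notin> set (passages U' @ passages V)"
  proof -
    have "distinct (passages (gauss D))"
      using gauss_diagram_gauss[OF D4(3) signs(1)] by (simp add: gauss_diagram_def well_formed_def)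
    then have "C \<notin> set (u @ v)" "opp C \<notin> set (u @ v)"
      unfolding g(1) C_def by (auto simp: passages_def)
    then show "C \<notin> set (passages U' @ passages V)" "opp C \<notin> set (passages U' @ passages V)"
      unfolding D'(2)[symmetric] 2(3)[symmetric] by (auto simp: passages_def set_gauss C_def)
  qed
  have XC: "X \<noteq> C" "X \<noteq> opp C" "opp X \<noteq> C" by (simp_all add: X_def C_def)
  have psD: "passages D' = passages U' @ passages V" by (simp add: D')
  have "four_valent (U' @ [C, opp C] @ V) \<and> planar (U' @ [C, opp C] @ V)"
    by (rule insert_kink[OF D4(1,2) psD CX(1) C_new]) (simp add: CX)
  then have w1: "four_valent w1 \<and> planar w1"
    by (intro insert_kink[of "U' @ [C, opp C] @ V" "passages U' @ [C]" "opp C # passages V" X])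
      (use CX X_new XC in \<open>auto simp: w1_def\<close>)
  have "four_valent (U' @ [X, opp X] @ V) \<and> planar (U' @ [X, opp X] @ V)"
    by (rule insert_kink[OF D4(1,2) psD CX(2) X_new]) (simp add: CX)
  then have w2: "four_valent w2 \<and> planar w2"
    by (intro insert_kink[of "U' @ [X, opp X] @ V" "passages U' @ [X]" "opp X # passages V" C])
      (use CX C_new XC in \<open>auto simp: w2_def\<close>)
  have g1: "gauss w1 = gauss D"
    by (simp add: w1_def g(1) D'(2) 2(3) X_def C_def)
  have g2: "gauss w2 = u @ [Bar, C, opp C] @ v"
    by (simp add: w2_def D'(2) 2(3) X_def C_def)
  have "set (gauss w2) = set (gauss D)" unfolding g2 g(1) C_def by auto
  then have signs2: "consistent_signs (gauss w2)"
    using signs(1) by (simp add: consistent_signs_def)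
  have w12: "w1 \<in> diagrams" "w2 \<in> diagrams"
    using w1 w2 signs(1) signs2 by (simp_all add: diagrams_iff g1)
  have "(w1, w2) \<in> region_arc_shift_move"
    using bigon_shift[OF w12(1) w1_def CX] w12 unfolding w2_def[symmetric] region_arc_shift_move_def
    by fastforce
  moreover have "gauss_move (gauss D') (gauss w2)"
    unfolding gauss_move_def
  proof (intro conjI gauss_diagram_gauss)
    show "local_move (gauss D') (gauss w2)"
      using R1[of "u @ [Bar]" v c ov s] by (simp add: g(2) g2 C_def)
  qed (use D4 w2 signs(2) signs2 in auto)
  then have "equivclp gauss_move (gauss w2) (gauss D')"
    by (simp add: equivclp_sym r_into_equivclp)
  then have "(w2, D') \<in> diagram_equiv"
    using w12 D(2) by (simp add: diagram_equiv_def)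
  moreover have "(D, w1) \<in> diagram_equiv"
    using diagram_equiv_of_gauss_eq D(1) w12(1) g1 by simp
  ultimately show ?thesis by blast
qed

lemma forbidden_move_subset:
  "forbidden_move \<subseteq> diagram_equiv O region_arc_shift_move O diagram_equiv"
proof (rule subrelI)
  fix D D' assume "(D, D') \<in> forbidden_move"
  then have D: "D \<in> diagrams" "D' \<in> diagrams" and f: "forbidden (gauss D) (gauss D')"
    by (auto simp: forbidden_move_def)
  from f have "(D, D') \<in> diagram_equiv O region_arc_shift_move
      \<or> (D, D') \<in> diagram_equiv O region_arc_shift_move O diagram_equiv"
  proof cases
    case (F12 u c ov s d t v)
    then show ?thesis using region_arc_shift_of_exchange[OF D, of u c ov s "[]"] by simp
  next
    case (F34 u c ov s d t v)
    then show ?thesis using region_arc_shift_of_exchange[OF D, of u c ov s "[Bar]"] by simp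
  next
    case (T4 u c ov s v)
    then show ?thesis using region_arc_shift_of_T4[OF D] by simp
  qed
  moreover have "(D', D') \<in> diagram_equiv"
    using diagram_equiv_of_gauss_eq D(2) by simp
  ultimately show "(D, D') \<in> diagram_equiv O region_arc_shift_move O diagram_equiv" by blast
qed

section \<open>Comparison of the two numbers\<close>

text \<open>Each counted step becomes one step framed by equivalences, and adjacent equivalences
  merge by transitivity, so the number \<open>n\<close> is preserved exactly.\<close>

lemma relpow_simulation:
  assumes "trans E" "F \<subseteq> E O R O E"
  shows "(E O F) ^^ n O E \<subseteq> (E O R) ^^ n O E"
proof (induction n)
  case (Suc n)
  have EE: "E O E \<subseteq> E" using assms(1) by (auto simp: trans_def)
  have "(E O F) ^^ Suc n O E \<subseteq> (E O F) ^^ n O E O (E O R O E) O E"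
  proof -
    have "(E O F) ^^ Suc n O E = (E O F) ^^ n O E O F O E" by (simp add: O_assoc)
    also have "\<dots> \<subseteq> (E O F) ^^ n O E O (E O R O E) O E"
      by (intro relcomp_mono order.refl assms(2))
    finally show ?thesis .
  qed
  also have "\<dots> = ((E O F) ^^ n O E) O E O R O E O E"
    by (simp add: O_assoc)
  also have "\<dots> \<subseteq> ((E O R) ^^ n O E) O E O R O E"
    by (rule relcomp_mono[OF Suc.IH], intro relcomp_mono order.refl EE)
  also have "\<dots> = (E O R) ^^ n O (E O E) O R O E"
    by (simp add: O_assoc)
  also have "\<dots> \<subseteq> (E O R) ^^ n O E O R O E"
    by (intro relcomp_mono order.refl EE)
  finally show ?case by (simp add: O_assoc)
qed simp

theorem theorem5p5:
  fixes K :: "word set"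
  assumes "K \<in> twisted_knots"
  shows "region_arc_shift_number K \<le> forbidden_number K"
  unfolding region_arc_shift_number_def forbidden_number_def unknotting_number_def
proof (rule INF_superset_mono)
  show "{n. \<exists>D\<in>K. \<exists>D'\<in>trivial_diagrams. (D, D') \<in> (diagram_equiv O forbidden_move) ^^ n O diagram_equiv}
    \<subseteq> {n. \<exists>D\<in>K. \<exists>D'\<in>trivial_diagrams. (D, D') \<in> (diagram_equiv O region_arc_shift_move) ^^ n O diagram_equiv}"
    using relpow_simulation[OF trans_diagram_equiv forbidden_move_subset] by blast
qed simp

end
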